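(* Let $d$ and $n$ be positive integers. (i) There exists a Krull monoid that is not half-factorial, is truly $d$-congruence half-factorial, and has finite cyclic class group of order $n$, if and only if $d\in\Delta^{\ast}(C_n)$. (ii) There exists a Krull monoid that is not half-factorial, is $d$-congruence half-factorial, and has finite cyclic class group of order $n$, if and only if $d$ divides an element of $\Delta^{\ast}(C_n)$.
   Context: $C_n$ is the cyclic group of order $n$. A monoid is a commutative cancellative semigroup with identity; for $a\in H$, $\mathsf L(a)$ is the set of all $\ell\ge0$ such that $a$ is a product of $\ell$ irreducible elements of $H$. $H$ is half-factorial if $|\mathsf L(a)|=1$ for all $a$; it is $d$-congruence half-factorial if $\ell\equiv\ell'\pmod d$ for all $a\in H$ and $\ell,\ell'\in\mathsf L(a)$; it is truly $d$-congruence half-factorial if it is $d$-congruence half-factorial but not $d'$-congruence half-factorial for any multiple $d'\neq d$ of $d$. $H$ is a Krull monoid if there is a homomorphism $\varphi:H\to\mathcal F(P)$ into a free abelian monoid with $a\mid b$ iff $\varphi(a)\mid\varphi(b)$; its class group is $\mathsf q(\mathcal F(P))/\mathsf q(\varphi(H))$ for a divisor theory $\varphi$ (such a $\varphi$ where every $p\in P$ is the gcd of finitely many elements of $\varphi(H)$). For a finite abelian group $G$ and $G_0\subseteq G$: $\mathcal B(G_0)$ is the monoid of zero-sum sequences over $G_0$, with atoms the minimal zero-sum sequences; $\Delta(G_0)$ is the union over $B\in\mathcal B(G_0)$ of the sets of successive differences of the sets of lengths $\mathsf L(B)$; $\Delta^{\ast}(G)=\{\min\Delta(G_0):G_0\subseteq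 G,\ \Delta(G_0)\ne\emptyset\}$. *)

theory Defs
  imports
    "HOL-Algebra.Algebra"
    "HOL-Number_Theory.Cong"
    "HOL-Library.Multiset"
    "HOL-Library.Infinite_Typeclass"
begin

section \<open>Sets of lengths\<close>

text \<open>
  A monoid in the sense of factorization theory is a \<^locale>\<open>comm_monoid_cancel\<close>.
  By the usual convention, units have 0 as their only length, also in a monoid with non-trivial
  units (where a unit different from the identity is not literally an empty product).
\<close>

definition lengths :: "('a, 'm) monoid_scheme \<Rightarrow> 'a \<Rightarrow> nat set" where
  "lengths H a =
    (if a \<in> Units H then {0}
     else {length us | us. set us \<subseteq> carrier H \<and> factors H us a})"

definition half_factorial :: "('a, 'm) monoid_scheme \<Rightarrow> bool" where
  "half_factorial H \<longleftrightarrow> (\<forall>a\<in>carrier H. card (lengths H a) = 1)"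

definition congruence_half_factorial :: "nat \<Rightarrow> ('a, 'm) monoid_scheme \<Rightarrow> bool" where
  "congruence_half_factorial d H \<longleftrightarrow>
    (\<forall>a\<in>carrier H. \<forall>l\<in>lengths H a. \<forall>l'\<in>lengths H a. [l = l'] (mod d))"

text \<open>The moduli are positive, so \<open>0\<close> is not among the multiples of \<open>d\<close> considered here.\<close>

definition truly_congruence_half_factorial :: "nat \<Rightarrow> ('a, 'm) monoid_scheme \<Rightarrow> bool" where
  "truly_congruence_half_factorial d H \<longleftrightarrow>
    congruence_half_factorial d H \<and>
    (\<forall>d'>0. d dvd d' \<and> d' \<noteq> d \<longrightarrow> \<not> congruence_half_factorial d' H)"

section \<open>Krull monoids and their class groups\<close>

definition free_abelian_monoid :: "'p set \<Rightarrow> 'p multiset monoid" where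
  "free_abelian_monoid P =
    \<lparr>carrier = {S. set_mset S \<subseteq> P}, monoid.mult = (+), one = {#}\<rparr>"

definition divisor_homomorphism ::
  "('a, 'm) monoid_scheme \<Rightarrow> 'p set \<Rightarrow> ('a \<Rightarrow> 'p multiset) \<Rightarrow> bool" where
  "divisor_homomorphism H P \<phi> \<longleftrightarrow>
    \<phi> \<in> hom H (free_abelian_monoid P) \<and>
    (\<forall>a\<in>carrier H. \<forall>b\<in>carrier H.
      a divides\<^bsub>H\<^esub> b \<longleftrightarrow> \<phi> a divides\<^bsub>free_abelian_monoid P\<^esub> \<phi> b)"

definition gcd_of_set :: "('a, 'm) monoid_scheme \<Rightarrow> 'a \<Rightarrow> 'a set \<Rightarrow> bool" where
  "gcd_of_set G x A \<longleftrightarrow>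
    x \<in> carrier G \<and> (\<forall>a\<in>A. x divides\<^bsub>G\<^esub> a) \<and>
    (\<forall>y\<in>carrier G. (\<forall>a\<in>A. y divides\<^bsub>G\<^esub> a) \<longrightarrow> y divides\<^bsub>G\<^esub> x)"

definition divisor_theory ::
  "('a, 'm) monoid_scheme \<Rightarrow> 'p set \<Rightarrow> ('a \<Rightarrow> 'p multiset) \<Rightarrow> bool" where
  "divisor_theory H P \<phi> \<longleftrightarrow>
    divisor_homomorphism H P \<phi> \<and>
    (\<forall>p\<in>P. \<exists>A. finite A \<and> A \<subseteq> carrier H \<and>
      gcd_of_set (free_abelian_monoid P) {#p#} (\<phi> ` A))"

text \<open>
  The quotient group of the free abelian monoid on \<open>P\<close> is the free abelian group on \<open>P\<close>, into
  which a multiset is mapped as the formal sum of its elements.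
\<close>

definition frag_of_mset :: "'p multiset \<Rightarrow> 'p \<Rightarrow>\<^sub>0 int" where
  "frag_of_mset S = (\<Sum>p\<in>#S. frag_of p)"

definition quotient_subgroup :: "'p multiset set \<Rightarrow> ('p \<Rightarrow>\<^sub>0 int) set" where
  "quotient_subgroup M = {frag_of_mset S - frag_of_mset T | S T. S \<in> M \<and> T \<in> M}"

definition divisor_class_group ::
  "('a, 'm) monoid_scheme \<Rightarrow> 'p set \<Rightarrow> ('a \<Rightarrow> 'p multiset) \<Rightarrow> ('p \<Rightarrow>\<^sub>0 int) set monoid" where
  "divisor_class_group H P \<phi> = free_Abelian_group P Mod quotient_subgroup (\<phi> ` carrier H)"

text \<open>The \<open>itself\<close> argument is the type from which the primes \<open>P\<close> are drawn.\<close>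

definition krull_monoid :: "'p itself \<Rightarrow> ('a, 'm) monoid_scheme \<Rightarrow> bool" where
  "krull_monoid _ H \<longleftrightarrow>
    comm_monoid_cancel H \<and> (\<exists>(P :: 'p set) \<phi>. divisor_homomorphism H P \<phi>)"

definition has_class_group ::
  "'p itself \<Rightarrow> ('a, 'm) monoid_scheme \<Rightarrow> ('g, 'k) monoid_scheme \<Rightarrow> bool" where
  "has_class_group _ H G \<longleftrightarrow>
    (\<exists>(P :: 'p set) \<phi>. divisor_theory H P \<phi> \<and> divisor_class_group H P \<phi> \<cong> G)"

section \<open>Zero-sum sequences\<close>

text \<open>
  Sequences over \<open>G\<close> are unordered, hence multisets; \<open>G\<close> is an abelian group in multiplicative
  notation, so the sum of a sequence is written as a product.
\<close>

definition sequence_sum :: "('g, 'k) monoid_scheme \<Rightarrow> 'g multiset \<Rightarrow> 'g" where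
  "sequence_sum G S = (\<Otimes>\<^bsub>G\<^esub>g\<in>set_mset S. g [^]\<^bsub>G\<^esub> count S g)"

definition zero_sum_monoid :: "('g, 'k) monoid_scheme \<Rightarrow> 'g set \<Rightarrow> 'g multiset monoid" where
  "zero_sum_monoid G G\<^sub>0 =
    \<lparr>carrier = {S. set_mset S \<subseteq> G\<^sub>0 \<and> sequence_sum G S = \<one>\<^bsub>G\<^esub>}, monoid.mult = (+), one = {#}\<rparr>"

definition successive_differences :: "nat set \<Rightarrow> nat set" where
  "successive_differences L =
    {k - l | k l. l \<in> L \<and> k \<in> L \<and> l < k \<and> {l<..<k} \<inter> L = {}}"

definition Delta :: "('g, 'k) monoid_scheme \<Rightarrow> 'g set \<Rightarrow> nat set" where
  "Delta G G\<^sub>0 =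
    (\<Union>B\<in>carrier (zero_sum_monoid G G\<^sub>0).
      successive_differences (lengths (zero_sum_monoid G G\<^sub>0) B))"

definition Delta_star :: "('g, 'k) monoid_scheme \<Rightarrow> nat set" where
  "Delta_star G = {Inf (Delta G G\<^sub>0) | G\<^sub>0. G\<^sub>0 \<subseteq> carrier G \<and> Delta G G\<^sub>0 \<noteq> {}}"

end

(* Mapping an element of a Krull monoid H with class group G to the sequence of classes of its
   primes is a transfer homomorphism onto B(A), where A is the set of classes containing primes;
   it preserves sets of lengths. In B(A) every difference of lengths is a multiple of
   min Delta(A), so H is d-congruence half-factorial iff d divides min Delta(A).
   Conversely, a set A in C_n is the set of classes containing primes of some Krull monoid as soon
   as A generates C_n. If A generates a proper subgroup, of index divisible by a prime p, then
   some h in A has a p-th root h' such that every zero-sum sequence over A - {h} + h' contains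
   h' with a multiplicity divisible by p. Exchanging h for h' thus does not change the monoid of
   zero-sum sequences up to isomorphism, and repeating this makes the set generate C_n. *)

theory Submission
  imports Defs
begin

section \<open>Transfer homomorphisms\<close>

text \<open>\<open>Delta_star\<close> ranges over all subsets of C_n, whereas the classes containing
  primes always generate the class group; this mismatch is the obstacle in the converse direction.
  Passing to the generated subgroup would only realize a smaller class group, so the set itself has
  to be altered without touching its lengths.

  In the integers modulo n, the subgroup generated by A has index k = gcd(A, n). If k = p k', then
  h' arises by dividing a suitable representative h + t n of the class of h by p. It is chosen so
  that (h + t n)/k is prime to p; this is possible for some h, since otherwise k p would divide n
  and all of A. Then k divides i h' only if p divides i, which controls the multiplicity of h',
  because all other elements are multiples of k. As k does not divide h', the gcd drops strictly,
  and the process stops at 1.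

  The truly variant comes almost for free: H is d-congruence half-factorial exactly for the divisors
  d of one positive number m, and m is the only divisor without a larger multiple among
  them.\<close>

lemma (in comm_monoid_cancel) irreducible_iff:
  assumes "a \<in> carrier G"
  shows "irreducible G a \<longleftrightarrow> a \<notin> Units G \<and>
    (\<forall>b\<in>carrier G. \<forall>c\<in>carrier G. a = b \<otimes> c \<longrightarrow> b \<in> Units G \<or> c \<in> Units G)"
proof
  assume "irreducible G a"
  then show "a \<notin> Units G \<and>
    (\<forall>b\<in>carrier G. \<forall>c\<in>carrier G. a = b \<otimes> c \<longrightarrow> b \<in> Units G \<or> c \<in> Units G)"
    by (auto simp: irreducible_def intro: properfactorI3)
next
  assume *: "a \<notin> Units G \<and>
    (\<forall>b\<in>carrier G. \<forall>c\<in>carrier G. a = b \<otimes> c \<longrightarrow> b \<in> Units G \<or> c \<in> Units G)"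
  show "irreducible G a"
  proof (rule irreducibleI)
    fix b
    assume b: "b \<in> carrier G" and pf: "properfactor G b a"
    then obtain c where c: "c \<in> carrier G" "a = b \<otimes> c"
      by (auto simp: properfactor_def factor_def)
    have "c \<notin> Units G"
    proof
      assume "c \<in> Units G"
      then have "b = a \<otimes> inv c" "inv c \<in> carrier G"
        using b c by (auto simp: m_assoc)
      then have "a divides b" by (auto simp: factor_def)
      then show False using pf by (simp add: properfactor_def)
    qed
    then show "b \<in> Units G" using * b c by blast
  qed (use * in blast)
qed

text \<open>Surjectivity and the lifting of factorizations are usually asked for up to units of the
  target only. The targets below are monoids of zero-sum sequences, whose only unit is the empty
  sequence, so equality is the right form.\<close>

locale transfer_homomorphism =
  H: comm_monoid_cancel H + B: comm_monoid_cancel B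
  for H :: "('a, 'k) monoid_scheme" and B :: "('b, 'l) monoid_scheme" +
  fixes \<theta> :: "'a \<Rightarrow> 'b"
  assumes hom: "\<theta> \<in> hom H B"
    and surj: "\<theta> ` carrier H = carrier B"
    and unit: "\<And>a. a \<in> carrier H \<Longrightarrow> \<theta> a \<in> Units B \<Longrightarrow> a \<in> Units H"
    and split: "\<And>a b c. a \<in> carrier H \<Longrightarrow> b \<in> carrier B \<Longrightarrow> c \<in> carrier B \<Longrightarrow>
      \<theta> a = b \<otimes>\<^bsub>B\<^esub> c \<Longrightarrow>
      \<exists>u\<in>carrier H. \<exists>v\<in>carrier H. a = u \<otimes>\<^bsub>H\<^esub> v \<and> \<theta> u = b \<and> \<theta> v = c"
begin

lemma closed: "a \<in> carrier H \<Longrightarrow> \<theta> a \<in> carrier B"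
  using hom by (auto simp: hom_def)

lemma mult: "a \<in> carrier H \<Longrightarrow> b \<in> carrier H \<Longrightarrow> \<theta> (a \<otimes>\<^bsub>H\<^esub> b) = \<theta> a \<otimes>\<^bsub>B\<^esub> \<theta> b"
  using hom by (auto simp: hom_def)

lemma one: "\<theta> \<one>\<^bsub>H\<^esub> = \<one>\<^bsub>B\<^esub>"
proof -
  have "\<theta> \<one>\<^bsub>H\<^esub> \<otimes>\<^bsub>B\<^esub> \<theta> \<one>\<^bsub>H\<^esub> = \<theta> \<one>\<^bsub>H\<^esub> \<otimes>\<^bsub>B\<^esub> \<one>\<^bsub>B\<^esub>"
    using mult[of "\<one>\<^bsub>H\<^esub>" "\<one>\<^bsub>H\<^esub>"] closed by simp
  then show ?thesis using B.l_cancel closed by blast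
qed

lemma unit_iff: "a \<in> carrier H \<Longrightarrow> \<theta> a \<in> Units B \<longleftrightarrow> a \<in> Units H"
proof
  assume "a \<in> Units H"
  then obtain b where b: "a \<in> carrier H" "b \<in> carrier H" "a \<otimes>\<^bsub>H\<^esub> b = \<one>\<^bsub>H\<^esub>"
    by (auto simp: Units_def)
  then have "\<theta> a \<otimes>\<^bsub>B\<^esub> \<theta> b = \<one>\<^bsub>B\<^esub>" using mult one by metis
  then show "\<theta> a \<in> Units B"
    using b(1,2) closed B.m_comm[of "\<theta> a" "\<theta> b"] by (auto simp: Units_def)
qed (rule unit)

lemma irreducible_iff:
  assumes a: "a \<in> carrier H"
  shows "irreducible B (\<theta> a) \<longleftrightarrow> irreducible H a"
proof
  assume irr: "irreducible B (\<theta> a)"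
  have "b \<in> Units H \<or> c \<in> Units H"
    if bc: "b \<in> carrier H" "c \<in> carrier H" "a = b \<otimes>\<^bsub>H\<^esub> c" for b c
    using irr bc a mult[OF bc(1,2)] closed[OF bc(1)] closed[OF bc(2)] closed[OF a]
      unit_iff[OF bc(1)] unit_iff[OF bc(2)]
    by (simp add: B.irreducible_iff) blast
  then show "irreducible H a"
    using irr a unit_iff closed by (auto simp: B.irreducible_iff H.irreducible_iff)
next
  assume irr: "irreducible H a"
  have "b \<in> Units B \<or> c \<in> Units B"
    if bc: "b \<in> carrier B" "c \<in> carrier B" "\<theta> a = b \<otimes>\<^bsub>B\<^esub> c" for b c
    using split[OF a bc] irr a unit_iff by (auto simp: H.irreducible_iff)
  then show "irreducible B (\<theta> a)"
    using irr a unit_iff closed by (auto simp: B.irreducible_iff H.irreducible_iff)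
qed

lemma foldr_mult:
  "set us \<subseteq> carrier H \<Longrightarrow> \<theta> (foldr (\<otimes>\<^bsub>H\<^esub>) us \<one>\<^bsub>H\<^esub>) = foldr (\<otimes>\<^bsub>B\<^esub>) (map \<theta> us) \<one>\<^bsub>B\<^esub>"
  by (induction us) (auto simp: one mult)

lemma factors_map: "set us \<subseteq> carrier H \<Longrightarrow> factors H us a \<Longrightarrow> factors B (map \<theta> us) (\<theta> a)"
  using foldr_mult irreducible_iff by (auto simp: factors_def)

text \<open>\<open>split\<close> peels off one factor at a time, and each lifted factor is again
  irreducible. The empty list is excluded because \<open>\<theta> a = \<one>\<close> only makes
  \<open>a\<close> a unit, and a unit other than \<open>\<one>\<close> has no empty
  factorization.\<close>

lemma factors_lift:
  assumes "a \<in> carrier H" "vs \<noteq> []" "set vs \<subseteq> carrier B" "factors B vs (\<theta> a)"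
  shows "\<exists>us. set us \<subseteq> carrier H \<and> factors H us a \<and> length us = length vs"
  using assms
proof (induction vs arbitrary: a)
  case (Cons v vs)
  show ?case
  proof (cases "vs = []")
    case True
    then have "factors H [a] a"
      using Cons.prems irreducible_iff[of a] by (auto simp: factors_def)
    then show ?thesis using True Cons.prems(1) by (intro exI[of _ "[a]"]) auto
  next
    case False
    define w where "w = foldr (\<otimes>\<^bsub>B\<^esub>) vs \<one>\<^bsub>B\<^esub>"
    have w: "w \<in> carrier B" "factors B vs w" "\<theta> a = v \<otimes>\<^bsub>B\<^esub> w" "irreducible B v"
      using Cons.prems by (auto simp: w_def factors_def)
    obtain u u' where u: "u \<in> carrier H" "u' \<in> carrier H" "a = u \<otimes>\<^bsub>H\<^esub> u'" "\<theta> u = v" "\<theta> u' = w"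
      using split[OF Cons.prems(1) _ w(1,3)] Cons.prems(3) by auto
    obtain us where us: "set us \<subseteq> carrier H" "factors H us u'" "length us = length vs"
      using Cons.IH[of u'] False u w Cons.prems(3) by auto
    have "factors H (u # us) a"
      using H.factors_mult_single[of u us u'] us u w irreducible_iff[of u] by auto
    then show ?thesis using us u by (intro exI[of _ "u # us"]) auto
  qed
qed simp

lemma lengths_eq:
  assumes a: "a \<in> carrier H"
  shows "lengths H a = lengths B (\<theta> a)"
proof (cases "a \<in> Units H")
  case False
  have "\<exists>vs. length us = length vs \<and> set vs \<subseteq> carrier B \<and> factors B vs (\<theta> a)"
    if "set us \<subseteq> carrier H" "factors H us a" for us
    using that factors_map closed by (intro exI[of _ "map \<theta> us"]) auto
  moreover have "\<exists>us. length vs = length us \<and> set us \<subseteq> carrier H \<and> factors H us a"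
    if vs: "set vs \<subseteq> carrier B" "factors B vs (\<theta> a)" for vs
  proof -
    have "vs \<noteq> []"
      using vs False a unit_iff[of a] B.Units_one_closed by (metis factors_def foldr.simps(1) id_apply)
    then show ?thesis using factors_lift[OF a _ vs] by metis
  qed
  ultimately show ?thesis
    using False a unit_iff[of a] by (auto simp: lengths_def)
qed (use a unit_iff in \<open>auto simp: lengths_def\<close>)

lemma half_factorial_iff: "half_factorial H \<longleftrightarrow> half_factorial B"
  unfolding half_factorial_def surj[symmetric] by (simp add: lengths_eq)

lemma congruence_half_factorial_iff:
  "congruence_half_factorial d H \<longleftrightarrow> congruence_half_factorial d B"
  unfolding congruence_half_factorial_def surj[symmetric] by (simp add: lengths_eq)

text \<open>With \<open>successive_differences\<close> for \<open>f\<close> this shows that transfer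
  homomorphisms between monoids of zero-sum sequences preserve \<open>Delta\<close>.\<close>

lemma UN_lengths_eq: "(\<Union>a\<in>carrier H. f (lengths H a)) = (\<Union>b\<in>carrier B. f (lengths B b))"
  unfolding surj[symmetric] by (simp add: lengths_eq)

end

lemma transfer_homomorphism_if_iso:
  assumes "comm_monoid_cancel H" "comm_monoid_cancel B"
    and hom: "\<theta> \<in> hom H B" and bij: "bij_betw \<theta> (carrier H) (carrier B)"
  shows "transfer_homomorphism H B \<theta>"
proof -
  interpret H: comm_monoid_cancel H by fact
  interpret B: comm_monoid_cancel B by fact
  have mult: "\<theta> (a \<otimes>\<^bsub>H\<^esub> b) = \<theta> a \<otimes>\<^bsub>B\<^esub> \<theta> b" "\<theta> a \<in> carrier B"
    if "a \<in> carrier H" "b \<in> carrier H" for a b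
    using hom that by (auto simp: hom_def)
  have inj: "inj_on \<theta> (carrier H)" and surj: "\<theta> ` carrier H = carrier B"
    using bij by (auto simp: bij_betw_def)
  have one: "\<theta> \<one>\<^bsub>H\<^esub> = \<one>\<^bsub>B\<^esub>"
  proof -
    have "\<theta> \<one>\<^bsub>H\<^esub> \<otimes>\<^bsub>B\<^esub> \<theta> \<one>\<^bsub>H\<^esub> = \<theta> \<one>\<^bsub>H\<^esub> \<otimes>\<^bsub>B\<^esub> \<one>\<^bsub>B\<^esub>"
      using mult[of "\<one>\<^bsub>H\<^esub>" "\<one>\<^bsub>H\<^esub>"] by simp
    then show ?thesis using B.l_cancel mult(2) by blast
  qed
  have split: "\<exists>u\<in>carrier H. \<exists>v\<in>carrier H. a = u \<otimes>\<^bsub>H\<^esub> v \<and> \<theta> u = b \<and> \<theta> v = c"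
    if a: "a \<in> carrier H" and bc: "b \<in> carrier B" "c \<in> carrier B" and eq: "\<theta> a = b \<otimes>\<^bsub>B\<^esub> c"
    for a b c
  proof -
    obtain u v where uv: "u \<in> carrier H" "v \<in> carrier H" "\<theta> u = b" "\<theta> v = c"
      using bc surj by (metis imageE)
    then have "a = u \<otimes>\<^bsub>H\<^esub> v"
      using inj a eq mult(1)[of u v] by (auto intro: inj_onD)
    then show ?thesis using uv by blast
  qed
  show ?thesis
  proof
    fix a assume a: "a \<in> carrier H" "\<theta> a \<in> Units B"
    then obtain b where b: "b \<in> carrier B" "\<theta> a \<otimes>\<^bsub>B\<^esub> b = \<one>\<^bsub>B\<^esub>"
      by (auto simp: Units_def)
    obtain c where c: "c \<in> carrier H" "\<theta> c = b" using b surj by (metis imageE)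
    have "a \<otimes>\<^bsub>H\<^esub> c = \<one>\<^bsub>H\<^esub>"
      using inj a b c mult(1)[of a c] one by (auto intro!: inj_onD[OF inj])
    then show "a \<in> Units H" using a(1) c(1) H.m_comm[of a c] by (auto simp: Units_def)
  qed (use hom surj split in auto)
qed

section \<open>Zero-sum sequences\<close>

text \<open>Elements outside \<open>S\<close> enter with exponent 0, so two sequences can be
  compared over a common index set.\<close>

lemma (in comm_monoid) sequence_sum_eq_finprod:
  assumes "finite A" "A \<subseteq> carrier G" "set_mset S \<subseteq> A"
  shows "sequence_sum G S = (\<Otimes>g\<in>A. g [^] count S g)"
  unfolding sequence_sum_def
  using assms by (intro finprod_mono_neutral_cong_left) (auto simp: not_in_iff)

lemma (in comm_monoid) sequence_sum_union:
  assumes "set_mset S \<subseteq> carrier G" "set_mset T \<subseteq> carrier G"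
  shows "sequence_sum G (S + T) = sequence_sum G S \<otimes> sequence_sum G T"
proof -
  let ?A = "set_mset (S + T)"
  have A: "finite ?A" "?A \<subseteq> carrier G" using assms by auto
  have "sequence_sum G (S + T) = (\<Otimes>g\<in>?A. g [^] count S g \<otimes> g [^] count T g)"
    unfolding sequence_sum_def using A by (intro finprod_cong') (auto simp: nat_pow_mult)
  also have "\<dots> = (\<Otimes>g\<in>?A. g [^] count S g) \<otimes> (\<Otimes>g\<in>?A. g [^] count T g)"
    using A by (intro finprod_multf) auto
  finally show ?thesis
    using sequence_sum_eq_finprod[OF A, of S] sequence_sum_eq_finprod[OF A, of T] by simp
qed

lemma (in comm_monoid) sequence_sum_closed:
  "set_mset S \<subseteq> carrier G \<Longrightarrow> sequence_sum G S \<in> carrier G"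
  unfolding sequence_sum_def by (intro finprod_closed) auto

lemma (in comm_monoid) sequence_sum_empty: "sequence_sum G {#} = \<one>"
  by (simp add: sequence_sum_def)

lemma (in comm_monoid) sequence_sum_single:
  "g \<in> carrier G \<Longrightarrow> sequence_sum G {#g#} = g"
  by (simp add: sequence_sum_def)

lemma set_repeat_mset_subset: "set_mset (repeat_mset k S) \<subseteq> set_mset S"
  by (induction k) auto

lemma image_mset_repeat_mset: "image_mset f (repeat_mset k S) = repeat_mset k (image_mset f S)"
  by (induction k) auto

lemma (in comm_monoid) sequence_sum_repeat:
  assumes "set_mset S \<subseteq> carrier G"
  shows "sequence_sum G (repeat_mset k S) = sequence_sum G S [^] k"
proof (induction k)
  case (Suc k)
  have "set_mset (repeat_mset k S) \<subseteq> carrier G"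
    using set_repeat_mset_subset assms by (rule subset_trans)
  then show ?case
    using Suc assms by (simp add: sequence_sum_union sequence_sum_closed m_comm)
qed (simp add: sequence_sum_empty)

lemma carrier_zero_sum_monoid_iff:
  "S \<in> carrier (zero_sum_monoid G A) \<longleftrightarrow> set_mset S \<subseteq> A \<and> sequence_sum G S = \<one>\<^bsub>G\<^esub>"
  by (simp add: zero_sum_monoid_def)

lemma zero_sum_monoid_simps [simp]:
  "S \<otimes>\<^bsub>zero_sum_monoid G A\<^esub> T = S + T"
  "\<one>\<^bsub>zero_sum_monoid G A\<^esub> = {#}"
  by (simp_all add: zero_sum_monoid_def)

locale zero_sum_sequences = comm_group G for G (structure) +
  fixes A
  assumes subset: "A \<subseteq> carrier G"
begin

abbreviation B where "B \<equiv> zero_sum_monoid G A"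

sublocale B: comm_monoid_cancel B
proof (rule comm_monoid_cancelI)
  show "comm_monoid B"
    by (rule comm_monoidI) (use subset in \<open>auto simp: carrier_zero_sum_monoid_iff sequence_sum_union sequence_sum_empty\<close>)
qed auto

lemma Units_eq: "Units B = {{#}}"
  by (auto simp: Units_def carrier_zero_sum_monoid_iff sequence_sum_empty)

lemma irreducible_nonempty: "irreducible B S \<Longrightarrow> S \<noteq> {#}"
  by (auto simp: irreducible_def Units_eq)

text \<open>The empty sequence is the only unit, and the empty list is its only factorization, so
  the special case for units in \<open>lengths\<close> disappears.\<close>

lemma lengths_eq: "lengths B S = {length us | us. set us \<subseteq> carrier B \<and> factors B us S}"
proof (cases "S = {#}")
  case True
  have "us = []" if "factors B us {#}" for us
    using that by (cases us) (auto simp: factors_def dest: irreducible_nonempty)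
  moreover have "factors B [] {#}" by (simp add: factors_def)
  ultimately show ?thesis using True by (auto simp: lengths_def Units_eq)
qed (simp add: lengths_def Units_eq)

lemma lengths_add:
  assumes "l \<in> lengths B S" "k \<in> lengths B T"
  shows "l + k \<in> lengths B (S + T)"
proof -
  obtain us vs where "set us \<subseteq> carrier B" "factors B us S" "length us = l"
    "set vs \<subseteq> carrier B" "factors B vs T" "length vs = k"
    using assms by (auto simp: lengths_eq)
  then show ?thesis
    using B.factors_mult[of us S vs T]
    by (auto simp: lengths_eq intro!: exI[of _ "us @ vs"])
qed

text \<open>Induction on the size: a nonempty sequence that is not an atom splits into two shorter
  zero-sum sequences.\<close>

lemma lengths_nonempty: "S \<in> carrier B \<Longrightarrow> lengths B S \<noteq> {}"
proof (induction "size S" arbitrary: S rule: less_induct)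
  case less
  consider "S = {#}" | "irreducible B S" | U V where "U \<in> carrier B" "V \<in> carrier B" "S = U + V"
    "U \<noteq> {#}" "V \<noteq> {#}"
    using B.irreducible_iff[OF less.prems] unfolding Units_eq singleton_iff
      zero_sum_monoid_simps by blast
  then show ?case
  proof cases
    case 1
    then show ?thesis by (simp add: lengths_def Units_eq)
  next
    case 2
    then have "factors B [S] S" by (simp add: factors_def)
    then show ?thesis using less.prems by (auto simp: lengths_eq intro!: exI[of _ "[S]"])
  next
    case 3
    then have "lengths B U \<noteq> {}" "lengths B V \<noteq> {}"
      using less.hyps by (auto simp: nonempty_has_size)
    then show ?thesis using lengths_add 3(3) by blast
  qed
qed

lemma lengths_multiple:
  "l \<in> lengths B S \<Longrightarrow> q * l \<in> lengths B (repeat_mset q S)"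
proof (induction q)
  case 0
  then show ?case by (simp add: lengths_def Units_eq)
next
  case (Suc q)
  then show ?case using lengths_add[of l S "q * l" "repeat_mset q S"] by simp
qed

lemma carrier_repeat: "S \<in> carrier B \<Longrightarrow> repeat_mset q S \<in> carrier B"
proof (induction q)
  case (Suc q)
  then show ?case using B.m_closed[of S "repeat_mset q S"] by simp
qed (simp add: carrier_zero_sum_monoid_iff sequence_sum_empty)

section \<open>Differences of lengths and the minimum of \<open>Delta\<close>\<close>

lemma Delta_le_difference:
  assumes S: "S \<in> carrier B" and l: "l \<in> lengths B S" and k: "k \<in> lengths B S" and "l < k"
  shows "\<exists>e\<in>Delta G A. e \<le> k - l"
proof -
  \<comment> \<open>\<open>m\<close> is the length next to \<open>l\<close>, which makes
    \<open>m - l\<close> a successive difference.\<close>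
  define m where "m = (LEAST m. m \<in> lengths B S \<and> l < m)"
  have m: "m \<in> lengths B S \<and> l < m"
    unfolding m_def by (rule LeastI[of _ k]) (use k \<open>l < k\<close> in auto)
  have "m \<le> k" unfolding m_def by (rule Least_le) (use k \<open>l < k\<close> in auto)
  have "{l<..<m} \<inter> lengths B S = {}"
    using not_less_Least[of _ "\<lambda>m. m \<in> lengths B S \<and> l < m"] by (auto simp: m_def)
  then have "m - l \<in> Delta G A"
    using S l m unfolding Delta_def successive_differences_def by blast
  then show ?thesis using \<open>m \<le> k\<close> by (intro bexI[of _ "m - l"]) auto
qed

lemma DeltaE:
  assumes "e \<in> Delta G A"
  obtains S l where "S \<in> carrier B" "l \<in> lengths B S" "l + e \<in> lengths B S" "e > 0"
proof -
  obtain S l k where "S \<in> carrier B" "l \<in> lengths B S" "k \<in> lengths B S" "l < k" "e = k - l"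
    using assms unfolding Delta_def successive_differences_def by blast
  then show ?thesis using that[of S l] by simp
qed

lemma half_factorial_iff: "half_factorial B \<longleftrightarrow> Delta G A = {}"
proof
  assume hf: "half_factorial B"
  show "Delta G A = {}"
  proof (rule ccontr)
    assume "Delta G A \<noteq> {}"
    then obtain e where "e \<in> Delta G A" by blast
    then obtain S l where S: "S \<in> carrier B" "l \<in> lengths B S" "l + e \<in> lengths B S" "e > 0"
      by (rule DeltaE)
    then obtain k where "lengths B S = {k}"
      using hf by (meson card_1_singletonE half_factorial_def)
    then show False using S by simp
  qed
next
  assume "Delta G A = {}"
  then have "l = k" if "S \<in> carrier B" "l \<in> lengths B S" "k \<in> lengths B S" for S l k
    using Delta_le_difference[OF that] Delta_le_difference[OF that(1,3,2)]
    by (cases l k rule: linorder_cases) auto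
  then have "\<exists>l. lengths B S = {l}" if "S \<in> carrier B" for S
    using lengths_nonempty[OF that] that by fast
  then show "half_factorial B"
    unfolding half_factorial_def by fastforce
qed

text \<open>The minimum of \<open>Delta\<close> divides every difference of lengths of a sequence \<open>S\<close>: if \<open>l\<close> and
  \<open>l + m\<close> are lengths of \<open>T\<close>, where \<open>m\<close> is the minimum, and \<open>S\<close> has lengths differing by
  \<open>q m + r\<close>, then \<open>S + q T\<close> has two lengths differing by \<open>r\<close>.\<close>

lemma Inf_Delta_dvd:
  assumes D: "Delta G A \<noteq> {}" and S: "S \<in> carrier B"
    and k: "k \<in> lengths B S" "k + e \<in> lengths B S"
  shows "Inf (Delta G A) dvd e"
proof -
  let ?m = "Inf (Delta G A)"
  have "?m \<in> Delta G A" using D by (rule Inf_nat_def1)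
  then obtain T l where T: "T \<in> carrier B" "l \<in> lengths B T" "l + ?m \<in> lengths B T" and m: "?m > 0"
    by (elim DeltaE)
  define q r where "q = e div ?m" and "r = e mod ?m"
  have e: "e = q * ?m + r" by (simp add: q_def r_def)
  let ?U = "S + repeat_mset q T"
  have U: "?U \<in> carrier B" using S T carrier_repeat B.m_closed[of S "repeat_mset q T"] by simp
  have "k + q * (l + ?m) \<in> lengths B ?U" "k + e + q * l \<in> lengths B ?U"
    using k T by (auto intro!: lengths_add lengths_multiple)
  moreover have "k + e + q * l - (k + q * (l + ?m)) = r"
    by (simp add: e algebra_simps)
  moreover have "k + q * (l + ?m) \<le> k + e + q * l" by (simp add: e algebra_simps)
  \<comment> \<open>A nonzero \<open>r\<close> would force an element of at most \<open>r\<close>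
    into \<open>Delta\<close>, below its minimum.\<close>
  ultimately have "r = 0 \<or> (\<exists>e'\<in>Delta G A. e' \<le> r)"
    using Delta_le_difference[OF U] by (metis diff_is_0_eq linorder_not_le)
  moreover have "?m \<le> e'" if "e' \<in> Delta G A" for e'
    using that by (simp add: cInf_lower)
  moreover have "r < ?m" using m by (simp add: r_def)
  ultimately have "r = 0" by fastforce
  then show ?thesis by (simp add: e)
qed

lemma congruence_half_factorial_iff:
  assumes D: "Delta G A \<noteq> {}"
  shows "congruence_half_factorial d B \<longleftrightarrow> d dvd Inf (Delta G A)"
proof
  assume c: "congruence_half_factorial d B"
  have "Inf (Delta G A) \<in> Delta G A" using D by (rule Inf_nat_def1)
  then obtain S l where "S \<in> carrier B" "l \<in> lengths B S" "l + Inf (Delta G A) \<in> lengths B S"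
    by (elim DeltaE)
  then have "[l + Inf (Delta G A) = l] (mod d)"
    using c by (auto simp: congruence_half_factorial_def)
  then show "d dvd Inf (Delta G A)" by (simp add: cong_add_lcancel_0_nat cong_0_iff)
next
  assume d: "d dvd Inf (Delta G A)"
  have "[l = k] (mod d)" if "S \<in> carrier B" "l \<in> lengths B S" "k \<in> lengths B S" "l \<le> k" for S l k
  proof -
    have "Inf (Delta G A) dvd k - l" using Inf_Delta_dvd[OF D that(1,2), of "k - l"] that by simp
    then show ?thesis using d that(4) by (metis cong_altdef_nat cong_sym dvd_trans)
  qed
  then show "congruence_half_factorial d B"
    unfolding congruence_half_factorial_def by (metis cong_sym nat_le_linear)
qed

lemma Inf_Delta_pos: "Delta G A \<noteq> {} \<Longrightarrow> Inf (Delta G A) > 0"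
  by (meson DeltaE Inf_nat_def1)

text \<open>Provides the nonempty set that \<open>ex_generating_set\<close> asks for: an exchange
  needs an element to replace.\<close>

lemma Delta_empty: "A = {} \<Longrightarrow> Delta G A = {}"
proof -
  assume "A = {}"
  then have "S = {#}" if "S \<in> carrier B" for S
    using that by (simp add: carrier_zero_sum_monoid_iff)
  moreover have "lengths B {#} = {0}" by (simp add: lengths_def Units_eq)
  ultimately have "e \<notin> Delta G A" for e by (metis DeltaE add_0 less_irrefl singletonD)
  then show ?thesis by blast
qed

end

section \<open>Divisor class groups\<close>

lemma free_abelian_monoid_simps [simp]:
  "S \<in> carrier (free_abelian_monoid P) \<longleftrightarrow> set_mset S \<subseteq> P"
  "S \<otimes>\<^bsub>free_abelian_monoid P\<^esub> T = S + T"
  "\<one>\<^bsub>free_abelian_monoid P\<^esub> = {#}"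
  by (simp_all add: free_abelian_monoid_def)

lemma divides_free_abelian_monoid_iff:
  "set_mset T \<subseteq> P \<Longrightarrow> S divides\<^bsub>free_abelian_monoid P\<^esub> T \<longleftrightarrow> S \<subseteq># T"
  unfolding factor_def by (auto simp: mset_subset_eq_exists_conv)

lemma frag_of_mset_simps [simp]:
  "frag_of_mset {#} = 0"
  "frag_of_mset (add_mset p S) = frag_of p + frag_of_mset S"
  "frag_of_mset (S + T) = frag_of_mset S + frag_of_mset T"
  by (simp_all add: frag_of_mset_def)

lemma lookup_frag_of_mset: "poly_mapping.lookup (frag_of_mset S) p = int (count S p)"
  by (induction S) (auto simp: lookup_add lookup_single when_def)

lemma frag_of_mset_inject [simp]: "frag_of_mset S = frag_of_mset T \<longleftrightarrow> S = T"
  by (metis lookup_frag_of_mset multiset_eqI of_nat_eq_iff)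

lemma keys_frag_of_mset [simp]: "Poly_Mapping.keys (frag_of_mset S) = set_mset S"
  by (auto simp: lookup_frag_of_mset in_keys_iff not_in_iff[symmetric])

text \<open>Lets the kernel in \<open>class_group_iso\<close> be computed with sequence
  sums.\<close>

lemma keys_subset_diff_frag_of_mset:
  assumes "Poly_Mapping.keys x \<subseteq> P"
  shows "\<exists>S T. set_mset S \<subseteq> P \<and> set_mset T \<subseteq> P \<and> x = frag_of_mset S - frag_of_mset T"
  using assms
proof (induction rule: free_Abelian_group_induct[consumes 1, case_names zero diff frag])
  case zero
  show ?case by (intro exI[of _ "{#}"]) simp
next
  case (diff x y)
  then obtain S T S' T' where "set_mset S \<subseteq> P" "set_mset T \<subseteq> P" "set_mset S' \<subseteq> P"
    "set_mset T' \<subseteq> P" "x = frag_of_mset S - frag_of_mset T" "y = frag_of_mset S' - frag_of_mset T'"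
    by blast
  then show ?case by (intro exI[of _ "S + T'"] exI[of _ "T + S'"]) auto
next
  case (frag p)
  then show ?case by (intro exI[of _ "{#p#}"] exI[of _ "{#}"]) simp
qed

section \<open>Divisor homomorphisms and the transfer to zero-sum sequences\<close>

locale divisor_hom = comm_monoid_cancel H for H (structure) +
  fixes P :: "'p set" and \<phi>
  assumes divisor_homomorphism: "divisor_homomorphism H P \<phi>"
begin

lemma closed: "a \<in> carrier H \<Longrightarrow> set_mset (\<phi> a) \<subseteq> P"
  using divisor_homomorphism hom_carrier[of \<phi> H "free_abelian_monoid P"]
  by (auto simp: divisor_homomorphism_def image_subset_iff)

lemma mult: "a \<in> carrier H \<Longrightarrow> b \<in> carrier H \<Longrightarrow> \<phi> (a \<otimes> b) = \<phi> a + \<phi> b"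
  using divisor_homomorphism by (auto simp: divisor_homomorphism_def hom_def)

lemma one: "\<phi> \<one> = {#}"
  using mult[of \<one> \<one>] by simp

lemma divides_iff: "a \<in> carrier H \<Longrightarrow> b \<in> carrier H \<Longrightarrow> a divides b \<longleftrightarrow> \<phi> a \<subseteq># \<phi> b"
  using divisor_homomorphism closed
  by (simp add: divisor_homomorphism_def divides_free_abelian_monoid_iff)

text \<open>The image of \<open>\<phi>\<close> is saturated: a multiset that is the difference of
  two images is itself an image, since \<open>b\<close> divides \<open>a\<close> as soon as
  \<open>\<phi> b\<close> divides \<open>\<phi> a\<close>.\<close>

lemma complement:
  assumes "a \<in> carrier H" "b \<in> carrier H" "\<phi> a = \<phi> b + S"
  shows "\<exists>c\<in>carrier H. a = b \<otimes> c \<and> \<phi> c = S"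
proof -
  have "b divides a" using assms divides_iff by simp
  then obtain c where c: "c \<in> carrier H" "a = b \<otimes> c" by (auto simp: factor_def)
  then show ?thesis using assms mult by auto
qed

text \<open>\<open>g\<close> sends a prime to its class, and \<open>img\<close> says that a product
  of primes comes from \<open>H\<close> exactly when its classes sum to zero. Splitting the sequence
  of classes splits the multiset of primes, and by \<open>img\<close> one part is an image;
  \<open>complement\<close> supplies the other.\<close>

lemma transfer_homomorphism:
  assumes "comm_group G" and g: "g ` P \<subseteq> carrier G"
    and img: "\<And>S. set_mset S \<subseteq> P \<Longrightarrow>
      S \<in> \<phi> ` carrier H \<longleftrightarrow> sequence_sum G (image_mset g S) = \<one>\<^bsub>G\<^esub>"
  shows "transfer_homomorphism H (zero_sum_monoid G (g ` P)) (\<lambda>a. image_mset g (\<phi> a))"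
proof -
  interpret Z: zero_sum_sequences G "g ` P"
    using assms by (simp add: zero_sum_sequences_def zero_sum_sequences_axioms_def)
  have in_B: "image_mset g (\<phi> a) \<in> carrier Z.B" if "a \<in> carrier H" for a
    using that closed[OF that] img[of "\<phi> a"] by (auto simp: carrier_zero_sum_monoid_iff)
  have lift: "\<exists>u\<in>carrier H. \<phi> u = S" if "set_mset S \<subseteq> P" "image_mset g S \<in> carrier Z.B" for S
    using that img[of S] by (auto simp: carrier_zero_sum_monoid_iff)
  show ?thesis
  proof
    show "(\<lambda>a. image_mset g (\<phi> a)) \<in> hom H Z.B"
      by (rule homI) (auto simp: in_B mult)
    have "S \<in> (\<lambda>a. image_mset g (\<phi> a)) ` carrier H" if S: "S \<in> carrier Z.B" for S
    proof -
      \<comment> \<open>One prime is chosen in each class.\<close>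
      define T where "T = image_mset (inv_into P g) S"
      have sub: "set_mset S \<subseteq> g ` P" using S by (simp add: carrier_zero_sum_monoid_iff)
      have "image_mset g T = image_mset (\<lambda>x. x) S"
        unfolding T_def multiset.map_comp
        using sub by (intro image_mset_cong) (auto simp: f_inv_into_f)
      moreover have "set_mset T \<subseteq> P"
        using sub by (auto simp: T_def intro: inv_into_into)
      ultimately show ?thesis using lift[of T] S by force
    qed
    then show "(\<lambda>a. image_mset g (\<phi> a)) ` carrier H = carrier Z.B"
      using in_B by blast
  next
    fix a assume a: "a \<in> carrier H" and "image_mset g (\<phi> a) \<in> Units Z.B"
    then have "\<phi> a = {#}" by (simp add: Z.Units_eq)
    \<comment> \<open>\<open>a\<close> may differ from \<open>\<one>\<close>, but it has the same
      image and hence divides it.\<close>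
    then obtain c where "c \<in> carrier H" "\<one> = a \<otimes> c"
      using complement[OF one_closed a, of "{#}"] one by auto
    then show "a \<in> Units H" using a m_comm[of a c] by (auto simp: Units_def)
  next
    fix a b c
    assume a: "a \<in> carrier H" and b: "b \<in> carrier Z.B" and c: "c \<in> carrier Z.B"
      and "image_mset g (\<phi> a) = b \<otimes>\<^bsub>Z.B\<^esub> c"
    then obtain S T where ST: "\<phi> a = S + T" "b = image_mset g S" "c = image_mset g T"
      using image_mset_eq_plusD[of g "\<phi> a" b c] by auto
    then obtain u where u: "u \<in> carrier H" "\<phi> u = S"
      using lift[of S] b closed[OF a] by auto
    then obtain v where "v \<in> carrier H" "a = u \<otimes> v" "\<phi> v = T"
      using complement[OF a u(1), of T] ST by auto
    then show "\<exists>u\<in>carrier H. \<exists>v\<in>carrier H.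
        a = u \<otimes> v \<and> image_mset g (\<phi> u) = b \<and> image_mset g (\<phi> v) = c"
      using u ST by blast
  qed
qed

section \<open>The class group as a quotient of the free abelian group on the primes\<close>

abbreviation Q where "Q \<equiv> quotient_subgroup (\<phi> ` carrier H)"

lemma mem_Q_iff: "x \<in> Q \<longleftrightarrow>
    (\<exists>a\<in>carrier H. \<exists>b\<in>carrier H. x = frag_of_mset (\<phi> a) - frag_of_mset (\<phi> b))"
  by (auto simp: quotient_subgroup_def)

lemma subgroup_Q: "subgroup Q (free_Abelian_group P)"
proof (rule group.subgroupI[OF group_free_Abelian_group])
  show Q_subset: "Q \<subseteq> carrier (free_Abelian_group P)"
  proof
    fix x assume "x \<in> Q"
    then obtain a b where ab: "a \<in> carrier H" "b \<in> carrier H"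
      and x: "x = frag_of_mset (\<phi> a) - frag_of_mset (\<phi> b)"
      by (auto simp: mem_Q_iff)
    have "Poly_Mapping.keys x \<subseteq> set_mset (\<phi> a) \<union> set_mset (\<phi> b)"
      unfolding x using keys_diff[of "frag_of_mset (\<phi> a)" "frag_of_mset (\<phi> b)"] by simp
    then show "x \<in> carrier (free_Abelian_group P)"
      using closed[OF ab(1)] closed[OF ab(2)] by auto
  qed
  have sub: "Poly_Mapping.keys x \<subseteq> P" if "x \<in> Q" for x
    using subsetD[OF Q_subset that] by simp
  show "Q \<noteq> {}" using mem_Q_iff[of 0] one_closed by (metis diff_self empty_iff)
  show "inv\<^bsub>free_Abelian_group P\<^esub> x \<in> Q" if "x \<in> Q" for x
    using that sub[OF that] by (auto simp: mem_Q_iff) (metis minus_diff_eq)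
  show "x \<otimes>\<^bsub>free_Abelian_group P\<^esub> y \<in> Q" if xy: "x \<in> Q" "y \<in> Q" for x y
  proof -
    obtain a b c d where "a \<in> carrier H" "b \<in> carrier H" "c \<in> carrier H" "d \<in> carrier H"
      "x = frag_of_mset (\<phi> a) - frag_of_mset (\<phi> b)" "y = frag_of_mset (\<phi> c) - frag_of_mset (\<phi> d)"
      using xy by (auto simp: mem_Q_iff)
    then show ?thesis
      unfolding mem_Q_iff
      by (intro bexI[of _ "a \<otimes> c"] bexI[of _ "b \<otimes> d"]) (auto simp: mult)
  qed
qed

text \<open>Saturation once more: by \<open>complement\<close>, passing to the quotient group of the
  image adds no new multisets.\<close>

lemma frag_of_mset_mem_Q_iff:
  assumes S: "set_mset S \<subseteq> P"
  shows "frag_of_mset S \<in> Q \<longleftrightarrow> S \<in> \<phi> ` carrier H"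
proof
  assume "frag_of_mset S \<in> Q"
  then obtain a b where ab: "a \<in> carrier H" "b \<in> carrier H"
    and "frag_of_mset S = frag_of_mset (\<phi> a) - frag_of_mset (\<phi> b)"
    by (auto simp: mem_Q_iff)
  then have "frag_of_mset (\<phi> a) = frag_of_mset (\<phi> b + S)" by (simp add: algebra_simps)
  then have "\<phi> a = \<phi> b + S" by (simp only: frag_of_mset_inject)
  then show "S \<in> \<phi> ` carrier H" using complement[OF ab] by auto
next
  assume "S \<in> \<phi> ` carrier H"
  then obtain a where a: "a \<in> carrier H" "S = \<phi> a" by auto
  then show "frag_of_mset S \<in> Q"
    unfolding mem_Q_iff by (intro bexI[of _ a] bexI[of _ \<one>]) (auto simp: one)
qed

lemma hom_frag_of_mset:
  assumes "comm_group G" "\<chi> \<in> hom (free_Abelian_group P) G" "set_mset S \<subseteq> P"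
  shows "\<chi> (frag_of_mset S) = sequence_sum G (image_mset (\<lambda>p. \<chi> (frag_of p)) S)"
proof -
  interpret G: comm_group G by fact
  have cl: "\<chi> x \<in> carrier G" if "Poly_Mapping.keys x \<subseteq> P" for x
    using assms(2) that by (auto simp: hom_def)
  show ?thesis using assms(3)
  proof (induction S)
    case empty
    have "\<chi> 0 = \<one>\<^bsub>G\<^esub>"
      using hom_one[OF assms(2) group_free_Abelian_group G.is_group] by simp
    then show ?case by (simp add: G.sequence_sum_empty)
  next
    case (add p S)
    have "\<chi> (frag_of p + frag_of_mset S) = \<chi> (frag_of p) \<otimes>\<^bsub>G\<^esub> \<chi> (frag_of_mset S)"
      using hom_mult[OF assms(2), of "frag_of p" "frag_of_mset S"] add.prems by simp
    also have "\<dots> = sequence_sum G {#\<chi> (frag_of p)#} \<otimes>\<^bsub>G\<^esub>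
        sequence_sum G (image_mset (\<lambda>p. \<chi> (frag_of p)) S)"
      using add cl[of "frag_of p"] by (simp add: G.sequence_sum_single)
    also have "\<dots> = sequence_sum G ({#\<chi> (frag_of p)#} + image_mset (\<lambda>p. \<chi> (frag_of p)) S)"
      using add.prems by (intro G.sequence_sum_union[symmetric]) (auto intro!: cl)
    finally show ?case by simp
  qed
qed

text \<open>\<open>g p\<close> is the class of the prime \<open>p\<close>: the coset map followed by
  the given isomorphism is a homomorphism with kernel \<open>Q\<close>, and a multiset lies in
  \<open>Q\<close> exactly when it is an image.\<close>

lemma ex_class_map:
  assumes "comm_group G" and iso: "divisor_class_group H P \<phi> \<cong> G"
  shows "\<exists>g. g ` P \<subseteq> carrier G \<and> (\<forall>S. set_mset S \<subseteq> P \<longrightarrow>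
    (S \<in> \<phi> ` carrier H \<longleftrightarrow> sequence_sum G (image_mset g S) = \<one>\<^bsub>G\<^esub>))"
proof -
  let ?F = "free_Abelian_group P"
  interpret G: comm_group G by fact
  interpret F: comm_group ?F by (rule abelian_free_Abelian_group)
  interpret Q: normal Q ?F using F.subgroup_imp_normal[OF subgroup_Q] .
  obtain f where f: "f \<in> iso (?F Mod Q) G"
    using iso by (auto simp: is_iso_def divisor_class_group_def)
  define \<chi> where "\<chi> = f \<circ> (\<lambda>x. Q #>\<^bsub>?F\<^esub> x)"
  have \<chi>: "\<chi> \<in> hom ?F G"
    unfolding \<chi>_def using f Q.r_coset_hom_Mod by (intro hom_compose) (auto simp: iso_def)
  have "f Q = \<one>\<^bsub>G\<^esub>"
    using hom_one[OF _ Q.factorgroup_is_group G.is_group, of f] f by (auto simp: iso_def FactGroup_def)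
  moreover have "inj_on f (rcosets\<^bsub>?F\<^esub> Q)"
    using f by (auto simp: iso_def bij_betw_def FactGroup_def)
  ultimately have ker: "\<chi> x = \<one>\<^bsub>G\<^esub> \<longleftrightarrow> x \<in> Q" if "x \<in> carrier ?F" for x
    using that F.coset_join1[OF _ that subgroup_Q] F.coset_join2[OF that subgroup_Q]
      F.rcosetsI[OF Q.subset that] Q.subgroup_in_rcosets[OF F.is_group]
      Q.subset unfolding \<chi>_def o_def by (metis inj_onD)
  let ?g = "\<lambda>p. \<chi> (frag_of p)"
  have "?g ` P \<subseteq> carrier G" using \<chi> by (auto simp: hom_def)
  moreover have "S \<in> \<phi> ` carrier H \<longleftrightarrow> sequence_sum G (image_mset ?g S) = \<one>\<^bsub>G\<^esub>"
    if "set_mset S \<subseteq> P" for S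
    using that hom_frag_of_mset[OF \<open>comm_group G\<close> \<chi> that] ker[of "frag_of_mset S"]
      frag_of_mset_mem_Q_iff[OF that] by simp
  ultimately show ?thesis by blast
qed

text \<open>The first isomorphism theorem for the homomorphism that extends \<open>g\<close> to the
  free abelian group: \<open>gen\<close> makes it onto, and \<open>img\<close> identifies its kernel
  with \<open>Q\<close>.\<close>

lemma class_group_iso:
  assumes "comm_group G" and fin: "finite (carrier G)" and g: "g ` P \<subseteq> carrier G"
    and img: "\<And>S. set_mset S \<subseteq> P \<Longrightarrow>
      S \<in> \<phi> ` carrier H \<longleftrightarrow> sequence_sum G (image_mset g S) = \<one>\<^bsub>G\<^esub>"
    and gen: "\<And>x. x \<in> carrier G \<Longrightarrow>
      \<exists>S. set_mset S \<subseteq> P \<and> sequence_sum G (image_mset g S) = x"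
  shows "divisor_class_group H P \<phi> \<cong> G"
proof -
  let ?F = "free_Abelian_group P"
  let ?\<sigma> = "\<lambda>S. sequence_sum G (image_mset g S)"
  interpret G: comm_group G by fact
  interpret F: comm_group ?F by (rule abelian_free_Abelian_group)
  obtain \<chi> where \<chi>: "\<chi> \<in> hom ?F G" and \<chi>_frag: "\<And>p. p \<in> P \<Longrightarrow> \<chi> (frag_of p) = g p"
    using G.free_Abelian_group_universal[OF g] by blast
  interpret \<chi>: group_hom ?F G \<chi>
    using \<chi> by (simp add: group_hom_def group_hom_axioms_def G.is_group)
  have \<chi>_eq: "\<chi> (frag_of_mset S) = ?\<sigma> S" if S: "set_mset S \<subseteq> P" for S
  proof -
    have "image_mset (\<lambda>p. \<chi> (frag_of p)) S = image_mset g S"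
      using S \<chi>_frag by (intro image_mset_cong) auto
    then show ?thesis using hom_frag_of_mset[OF \<open>comm_group G\<close> \<chi> S] by simp
  qed
  have \<sigma>_add: "?\<sigma> (S + T) = ?\<sigma> S \<otimes>\<^bsub>G\<^esub> ?\<sigma> T" if "set_mset S \<subseteq> P" "set_mset T \<subseteq> P" for S T
    using that g by (simp, intro G.sequence_sum_union) auto
  have \<sigma>_closed: "?\<sigma> S \<in> carrier G" if "set_mset S \<subseteq> P" for S
    using that g by (intro G.sequence_sum_closed) auto
  have "kernel ?F G \<chi> = Q"
  proof (intro equalityI subsetI)
    fix x assume x: "x \<in> kernel ?F G \<chi>"
    then have "Poly_Mapping.keys x \<subseteq> P" by (simp add: kernel_def)
    then obtain S T where S: "set_mset S \<subseteq> P" and T: "set_mset T \<subseteq> P"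
      and x_eq: "x = frag_of_mset S - frag_of_mset T"
      using keys_subset_diff_frag_of_mset by blast
    \<comment> \<open>An element of the kernel is a difference of multisets \<open>S\<close> and
      \<open>T\<close> of equal sum, which need not be zero. Adding \<open>U\<close> to both keeps
      the difference, and \<open>T + U\<close> is \<open>order G\<close> copies of \<open>T\<close>,
      hence zero-sum; so is \<open>S + U\<close>.\<close>
    define U where "U = repeat_mset (order G - 1) T"
    have U: "set_mset U \<subseteq> P" unfolding U_def using set_repeat_mset_subset T by (rule subset_trans)
    have "frag_of_mset S = x + frag_of_mset T" by (simp add: x_eq)
    then have "?\<sigma> S = \<chi> x \<otimes>\<^bsub>G\<^esub> ?\<sigma> T"
      using \<chi>_eq[OF S] \<chi>_eq[OF T] \<chi>.hom_mult[of x "frag_of_mset T"] x T by (simp add: kernel_def)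
    then have ST: "?\<sigma> S = ?\<sigma> T" using x \<sigma>_closed[OF T] by (simp add: kernel_def)
    have "?\<sigma> (T + U) = sequence_sum G (repeat_mset (order G) (image_mset g T))"
      using G.order_gt_0_iff_finite fin
      by (cases "order G") (auto simp: U_def image_mset_repeat_mset)
    also have "\<dots> = \<one>\<^bsub>G\<^esub>"
      using T g fin \<sigma>_closed[OF T] by (subst G.sequence_sum_repeat) (auto simp: G.pow_order_eq_1)
    finally have "?\<sigma> (T + U) = \<one>\<^bsub>G\<^esub>" .
    moreover from this have "?\<sigma> (S + U) = \<one>\<^bsub>G\<^esub>"
      using \<sigma>_add[OF S U] \<sigma>_add[OF T U] ST by simp
    ultimately have "S + U \<in> \<phi> ` carrier H" "T + U \<in> \<phi> ` carrier H"
      using img[of "S + U"] img[of "T + U"] S T U by auto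
    moreover have "x = frag_of_mset (S + U) - frag_of_mset (T + U)" by (simp add: x_eq)
    ultimately show "x \<in> Q" unfolding quotient_subgroup_def by blast
  next
    fix x assume x: "x \<in> Q"
    then have carr: "x \<in> carrier ?F" using subgroup.subset[OF subgroup_Q] by blast
    obtain a b where ab: "a \<in> carrier H" "b \<in> carrier H"
      and x_eq: "x = frag_of_mset (\<phi> a) - frag_of_mset (\<phi> b)"
      using x by (auto simp: mem_Q_iff)
    have \<chi>_\<phi>: "\<chi> (frag_of_mset (\<phi> c)) = \<one>\<^bsub>G\<^esub>" if "c \<in> carrier H" for c
      using \<chi>_eq img closed that by auto
    have "frag_of_mset (\<phi> a) = x + frag_of_mset (\<phi> b)" by (simp add: x_eq)
    then have "\<one>\<^bsub>G\<^esub> = \<chi> x \<otimes>\<^bsub>G\<^esub> \<one>\<^bsub>G\<^esub>"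
      using \<chi>.hom_mult[of x "frag_of_mset (\<phi> b)"] carr ab(2) closed[OF ab(2)]
        \<chi>_\<phi>[OF ab(1)] \<chi>_\<phi>[OF ab(2)] by simp
    then show "x \<in> kernel ?F G \<chi>" using carr \<chi>.hom_closed by (simp add: kernel_def)
  qed
  moreover have "\<chi> ` carrier ?F = carrier G"
  proof (intro equalityI subsetI)
    fix x assume "x \<in> carrier G"
    then obtain S where S: "set_mset S \<subseteq> P" "?\<sigma> S = x" using gen by blast
    then have "\<chi> (frag_of_mset S) = x" using \<chi>_eq by simp
    moreover have "frag_of_mset S \<in> carrier ?F" using S by simp
    ultimately show "x \<in> \<chi> ` carrier ?F" by blast
  qed auto
  ultimately show ?thesis
    using \<chi>.FactGroup_iso by (simp add: divisor_class_group_def)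
qed

end

text \<open>\<open>A\<close> is the set of classes of primes. One \<open>A\<close> serves all
  \<open>d\<close> at once, as the truly variant compares several moduli for the same
  \<open>H\<close>.\<close>

lemma ex_Delta_if_has_class_group:
  assumes H: "comm_monoid_cancel H" "\<not> half_factorial H" and G: "comm_group G"
    and cl: "has_class_group TYPE('p) H G"
  shows "\<exists>A\<subseteq>carrier G. Delta G A \<noteq> {} \<and>
    (\<forall>d. congruence_half_factorial d H \<longleftrightarrow> d dvd Inf (Delta G A))"
proof -
  obtain P :: "'p set" and \<phi> where dt: "divisor_theory H P \<phi>" and iso: "divisor_class_group H P \<phi> \<cong> G"
    using cl by (auto simp: has_class_group_def)
  interpret divisor_hom H P \<phi>
    using H dt by (simp add: divisor_hom_def divisor_hom_axioms_def divisor_theory_def)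
  obtain g where g: "g ` P \<subseteq> carrier G"
    "\<And>S. set_mset S \<subseteq> P \<Longrightarrow> S \<in> \<phi> ` carrier H \<longleftrightarrow> sequence_sum G (image_mset g S) = \<one>\<^bsub>G\<^esub>"
    using ex_class_map[OF G iso] by blast
  interpret Z: zero_sum_sequences G "g ` P"
    using G g by (simp add: zero_sum_sequences_def zero_sum_sequences_axioms_def)
  interpret T: transfer_homomorphism H Z.B "\<lambda>a. image_mset g (\<phi> a)"
    using transfer_homomorphism[OF G g] .
  show ?thesis
    using g(1) H(2) Z.half_factorial_iff Z.congruence_half_factorial_iff
      T.half_factorial_iff T.congruence_half_factorial_iff by blast
qed

section \<open>Realization\<close>

text \<open>Used to embed the multisets over a finite set of primes into an arbitrary infinite
  type.\<close>

lemma countable_multisets: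
  assumes "countable P"
  shows "countable {S. set_mset S \<subseteq> P}"
proof (rule countable_subset)
  show "{S. set_mset S \<subseteq> P} \<subseteq> mset ` lists P"
  proof
    fix S assume "S \<in> {S. set_mset S \<subseteq> P}"
    moreover obtain xs where "mset xs = S" using ex_mset by blast
    ultimately show "S \<in> mset ` lists P" by (auto intro!: imageI)
  qed
  show "countable (mset ` lists P)" using assms by simp
qed

text \<open>Two primes in each class \<open>a \<in> A\<close> suffice for a divisor theory: if \<open>p\<close> and \<open>q\<close> lie in
  the same class, then \<open>p\<close> is the greatest common divisor of \<open>p^N\<close> and \<open>p q^(N-1)\<close>, where
  \<open>N\<close> is the order of the class group.\<close>

lemma ex_Krull_monoid:
  assumes "comm_group G" and fin: "finite (carrier G)" and A: "A \<subseteq> carrier G"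
    and gen: "\<And>x. x \<in> carrier G \<Longrightarrow> \<exists>S. set_mset S \<subseteq> A \<and> sequence_sum G S = x"
  shows "\<exists>(H :: 'a::infinite monoid) \<theta>. krull_monoid TYPE('p::infinite) H \<and>
    has_class_group TYPE('p) H G \<and> transfer_homomorphism H (zero_sum_monoid G A) \<theta>"
proof -
  interpret G: comm_group G by fact
  have "finite (A \<times> (UNIV :: bool set))"
    using finite_subset[OF A fin] by (intro finite_cartesian_product) auto
  \<comment> \<open>The Boolean tells the two primes of a class apart; the injection moves them into
    the prescribed infinite type.\<close>
  then obtain j :: "_ \<times> bool \<Rightarrow> 'p" where j: "inj_on j (A \<times> UNIV)"
    using arb_inj_on_finite_infinite by blast
  define P where "P = j ` (A \<times> UNIV)"
  define g where "g = fst \<circ> inv_into (A \<times> UNIV) j"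
  have g_j [simp]: "g (j (a, i)) = a" if "a \<in> A" for a i
    using j that by (simp add: g_def)
  have gP: "g ` P = A" by (force simp: P_def)
  let ?\<sigma> = "\<lambda>S. sequence_sum G (image_mset g S)"
  have \<sigma>_add: "?\<sigma> (S + T) = ?\<sigma> S \<otimes>\<^bsub>G\<^esub> ?\<sigma> T" if "set_mset S \<subseteq> P" "set_mset T \<subseteq> P" for S T
    using that gP A by (simp, intro G.sequence_sum_union) auto
  have \<sigma>_closed: "?\<sigma> S \<in> carrier G" if "set_mset S \<subseteq> P" for S
    using that gP A by (intro G.sequence_sum_closed) auto

  have "finite P" using \<open>finite (A \<times> UNIV)\<close> by (simp add: P_def)
  \<comment> \<open>The natural model of the monoid is \<open>K\<close>, a set of multisets. As the
    elements must come from the type \<open>'a\<close>, the monoid \<open>H\<close> is a copy of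
    \<open>K\<close> along an injective coding \<open>e\<close>, with \<open>\<phi>\<close> as
    decoding.\<close>
  then obtain e1 :: "'p multiset \<Rightarrow> nat" where e1: "inj_on e1 {S. set_mset S \<subseteq> P}"
    using countable_multisets[OF countable_finite] by (auto simp: countable_def)
  obtain e2 :: "nat \<Rightarrow> 'a" where e2: "inj e2"
    using infinite_countable_subset[OF infinite_UNIV] by blast
  define e where "e = e2 \<circ> e1"
  define K where "K = {S. set_mset S \<subseteq> P \<and> ?\<sigma> S = \<one>\<^bsub>G\<^esub>}"
  have e: "inj_on e K"
    unfolding e_def using e1 e2
    by (intro comp_inj_on) (auto simp: K_def intro: inj_on_subset)
  define \<phi> where "\<phi> = inv_into K e"
  have \<phi>_e [simp]: "\<phi> (e S) = S" if "S \<in> K" for S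
    using e that by (simp add: \<phi>_def)
  have K_add: "S + T \<in> K" if "S \<in> K" "T \<in> K" for S T
    using that \<sigma>_add[of S T] by (auto simp: K_def)
  have K_empty: "{#} \<in> K" by (simp add: K_def G.sequence_sum_empty)
  \<comment> \<open>Saturation of \<open>K\<close>: it makes divisibility in \<open>H\<close> agree
    with inclusion of multisets.\<close>
  have K_diff: "T \<in> K" if "S \<in> K" "S + T \<in> K" for S T
    using that \<sigma>_add[of S T] \<sigma>_closed[of T] by (auto simp: K_def)
  define H where "H = \<lparr>carrier = e ` K, monoid.mult = (\<lambda>x y. e (\<phi> x + \<phi> y)), one = e {#}\<rparr>"
  have H_simps: "carrier H = e ` K" "x \<otimes>\<^bsub>H\<^esub> y = e (\<phi> x + \<phi> y)" "\<one>\<^bsub>H\<^esub> = e {#}" for x y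
    by (simp_all add: H_def)
  interpret H: comm_monoid_cancel H
  proof (rule comm_monoid_cancelI)
    show "comm_monoid H"
      by (rule comm_monoidI) (auto simp: H_simps K_add K_empty add_ac)
    fix a b c
    assume abc: "a \<otimes>\<^bsub>H\<^esub> c = b \<otimes>\<^bsub>H\<^esub> c" "a \<in> carrier H" "b \<in> carrier H" "c \<in> carrier H"
    then obtain S T U where STU: "S \<in> K" "T \<in> K" "U \<in> K" "a = e S" "b = e T" "c = e U"
      by (auto simp: H_simps)
    then have "e (S + U) = e (T + U)" using abc(1) by (simp add: H_simps)
    then have "S + U = T + U" using e STU K_add by (auto dest: inj_onD)
    then show "a = b" using STU by simp
  qed
  have img: "\<phi> ` carrier H = K" by (force simp: H_simps)
  have "divisor_homomorphism H P \<phi>"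
    unfolding divisor_homomorphism_def
  proof (intro conjI ballI)
    show "\<phi> \<in> hom H (free_abelian_monoid P)"
      by (rule homI) (auto simp: H_simps K_add, auto simp: K_def)
    fix a b assume "a \<in> carrier H" "b \<in> carrier H"
    then obtain S T where ST: "S \<in> K" "T \<in> K" "a = e S" "b = e T" by (auto simp: H_simps)
    have "a divides\<^bsub>H\<^esub> b \<longleftrightarrow> (\<exists>U\<in>K. T = S + U)"
      using ST e K_add by (auto simp: factor_def H_simps dest: inj_onD)
    also have "\<dots> \<longleftrightarrow> S \<subseteq># T"
      unfolding mset_subset_eq_exists_conv using ST(1,2) K_diff by blast
    finally show "a divides\<^bsub>H\<^esub> b \<longleftrightarrow> \<phi> a divides\<^bsub>free_abelian_monoid P\<^esub> \<phi> b"
      using ST by (simp add: divides_free_abelian_monoid_iff K_def)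
  qed
  then interpret D: divisor_hom H P \<phi>
    by unfold_locales
  have class_iff: "S \<in> \<phi> ` carrier H \<longleftrightarrow> ?\<sigma> S = \<one>\<^bsub>G\<^esub>" if "set_mset S \<subseteq> P" for S
    unfolding img using that by (simp add: K_def)
  have "\<exists>C. finite C \<and> C \<subseteq> carrier H \<and>
      gcd_of_set (free_abelian_monoid P) {#p#} (\<phi> ` C)" if p: "p \<in> P" for p
  proof -
    define N where "N = order G"
    have N: "N > 0" using fin G.order_gt_0_iff_finite by (simp add: N_def)
    obtain a i where ai: "a \<in> A" "p = j (a, i)" using p by (auto simp: P_def)
    define q where "q = j (a, \<not> i)"
    have q: "q \<in> P" "q \<noteq> p" "g q = a" "g p = a"
      using ai j by (auto simp: q_def P_def dest: inj_onD)
    define S T where "S = repeat_mset N {#p#}" and "T = add_mset p (repeat_mset (N - 1) {#q#})"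
    have *: "sequence_sum G (repeat_mset N {#a#}) = \<one>\<^bsub>G\<^esub>"
      using ai A fin by (subst G.sequence_sum_repeat)
        (auto simp: G.sequence_sum_single G.pow_order_eq_1 N_def)
    have "image_mset g S = repeat_mset N {#a#}" "image_mset g T = repeat_mset N {#a#}"
      using N q by (cases N; simp add: S_def T_def image_mset_repeat_mset)+
    then have ST: "S \<in> K" "T \<in> K"
      using * p q(1) by (auto simp: K_def S_def T_def split: if_splits)
    \<comment> \<open>\<open>S\<close> contains no prime but \<open>p\<close>, and \<open>T\<close>
      contains \<open>p\<close> just once, as \<open>q\<close> differs from
      \<open>p\<close>.\<close>
    have "R \<subseteq># {#p#}" if "R \<subseteq># S" "R \<subseteq># T" for R
    proof (rule mset_subset_eqI)
      fix x
      show "count R x \<le> count {#p#} x"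
        using mset_subset_eq_count[OF that(1), of x] mset_subset_eq_count[OF that(2), of x] q(2)
        by (auto simp: S_def T_def split: if_splits)
    qed
    moreover have "{#p#} \<subseteq># S" "{#p#} \<subseteq># T" using N by (auto simp: S_def T_def)
    ultimately have "gcd_of_set (free_abelian_monoid P) {#p#} {S, T}"
      using p ST by (auto simp: gcd_of_set_def divides_free_abelian_monoid_iff K_def)
    then show ?thesis
      using ST by (intro exI[of _ "{e S, e T}"]) (auto simp: H_simps)
  qed
  then have "divisor_theory H P \<phi>"
    using D.divisor_homomorphism by (simp add: divisor_theory_def)
  moreover have "\<exists>S. set_mset S \<subseteq> P \<and> ?\<sigma> S = x" if x: "x \<in> carrier G" for x
  proof -
    obtain S where S: "set_mset S \<subseteq> A" "sequence_sum G S = x" using gen[OF x] by blast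
    have "image_mset g (image_mset (\<lambda>a. j (a, True)) S) = image_mset (\<lambda>a. a) S"
      unfolding multiset.map_comp using S by (intro image_mset_cong) auto
    then show ?thesis
      using S by (intro exI[of _ "image_mset (\<lambda>a. j (a, True)) S"]) (auto simp: P_def)
  qed
  then have "divisor_class_group H P \<phi> \<cong> G"
    using gP A class_iff by (intro D.class_group_iso[of G g]) (auto simp: fin \<open>comm_group G\<close>)
  ultimately have "has_class_group TYPE('p) H G" by (auto simp: has_class_group_def)
  moreover have "krull_monoid TYPE('p) H"
    using H.is_comm_monoid_cancel D.divisor_homomorphism by (auto simp: krull_monoid_def)
  moreover have "transfer_homomorphism H (zero_sum_monoid G A) (\<lambda>a. image_mset g (\<phi> a))"
    using D.transfer_homomorphism[OF \<open>comm_group G\<close> _ class_iff] gP A by simp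
  ultimately show ?thesis by blast
qed

section \<open>Enlarging the set of classes\<close>

text \<open>Replacing every \<open>h\<close> by \<open>p\<close> copies of \<open>h'\<close> keeps
  the sum. Conversely, \<open>dvd\<close> allows the copies of \<open>h'\<close> in a zero-sum
  sequence to be grouped back into copies of \<open>h\<close>; no \<open>h'\<close> gets mixed up
  with an element of the original sequence, as \<open>h'\<close> is not in \<open>A\<close>.\<close>

lemma transfer_homomorphism_replace:
  assumes "comm_group G" and A: "A \<subseteq> carrier G" "h \<in> A" and h': "h' \<in> carrier G" "h' \<notin> A"
    and p: "p > 0" "h' [^]\<^bsub>G\<^esub> p = h"
    and dvd: "\<And>S. set_mset S \<subseteq> insert h' (A - {h}) \<Longrightarrow> sequence_sum G S = \<one>\<^bsub>G\<^esub> \<Longrightarrow>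
      p dvd count S h'"
  shows "\<exists>\<theta>. transfer_homomorphism (zero_sum_monoid G A)
    (zero_sum_monoid G (insert h' (A - {h}))) \<theta>"
proof -
  let ?A' = "insert h' (A - {h})"
  interpret Z: zero_sum_sequences G A
    using assms by (simp add: zero_sum_sequences_def zero_sum_sequences_axioms_def)
  interpret Z': zero_sum_sequences G ?A'
    using assms by (auto simp: zero_sum_sequences_def zero_sum_sequences_axioms_def)
  have h: "h \<in> carrier G" "h \<noteq> h'" using A h' by auto
  define \<theta> where "\<theta> S = filter_mset (\<lambda>x. x \<noteq> h) S + repeat_mset (p * count S h) {#h'#}" for S
  define \<psi> where "\<psi> T = filter_mset (\<lambda>x. x \<noteq> h') T + repeat_mset (count T h' div p) {#h#}" for T
  have sum_\<theta>: "sequence_sum G (\<theta> S) = sequence_sum G S" if S: "set_mset S \<subseteq> A" for S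
  proof -
    let ?F = "filter_mset (\<lambda>x. x \<noteq> h) S"
    have F: "set_mset ?F \<subseteq> carrier G" using S A by auto
    have r: "sequence_sum G (repeat_mset k {#x#}) = x [^]\<^bsub>G\<^esub> k" if "x \<in> carrier G" for k x
      using that by (subst Z.sequence_sum_repeat) (auto simp: Z.sequence_sum_single)
    have "S = ?F + repeat_mset (count S h) {#h#}"
      by (rule multiset_eqI) simp
    then have "sequence_sum G S = sequence_sum G (?F + repeat_mset (count S h) {#h#})" by simp
    also have "\<dots> = sequence_sum G ?F \<otimes>\<^bsub>G\<^esub> (h' [^]\<^bsub>G\<^esub> p) [^]\<^bsub>G\<^esub> count S h"
      unfolding p(2) r[OF h(1), symmetric] using F h(1) by (intro Z.sequence_sum_union) auto
    also have "\<dots> = sequence_sum G ?F \<otimes>\<^bsub>G\<^esub> sequence_sum G (repeat_mset (p * count S h) {#h'#})"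
      unfolding r[OF h'(1)] using h'(1) by (simp add: Z.nat_pow_pow)
    also have "\<dots> = sequence_sum G (\<theta> S)"
      unfolding \<theta>_def using F h'(1) by (intro Z.sequence_sum_union[symmetric]) auto
    finally show ?thesis ..
  qed
  have \<theta>_set: "set_mset (\<theta> S) \<subseteq> ?A'" if "set_mset S \<subseteq> A" for S
    using that by (auto simp: \<theta>_def split: if_splits)
  have \<psi>_set: "set_mset (\<psi> T) \<subseteq> A" if "set_mset T \<subseteq> ?A'" for T
    using that A by (auto simp: \<psi>_def split: if_splits)
  have \<psi>_\<theta>: "\<psi> (\<theta> S) = S" if S: "set_mset S \<subseteq> A" for S
  proof (rule multiset_eqI)
    fix x
    have "count S h' = 0" using S h' by (auto simp: count_eq_zero_iff)
    then show "count (\<psi> (\<theta> S)) x = count S x"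
      using h p by (simp add: \<psi>_def \<theta>_def)
  qed
  have \<theta>_\<psi>: "\<theta> (\<psi> T) = T" if T: "set_mset T \<subseteq> ?A'" "p dvd count T h'" for T
  proof (rule multiset_eqI)
    fix x
    have "count T h = 0" using T h by (auto simp: count_eq_zero_iff)
    then show "count (\<theta> (\<psi> T)) x = count T x"
      using h p T(2) by (simp add: \<psi>_def \<theta>_def)
  qed
  have "\<theta> \<in> hom Z.B Z'.B"
  proof (rule homI)
    show "\<theta> S \<in> carrier Z'.B" if "S \<in> carrier Z.B" for S
      using that \<theta>_set sum_\<theta> by (auto simp: carrier_zero_sum_monoid_iff)
    show "\<theta> (S \<otimes>\<^bsub>Z.B\<^esub> T) = \<theta> S \<otimes>\<^bsub>Z'.B\<^esub> \<theta> T" for S T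
      by (rule multiset_eqI) (simp add: \<theta>_def algebra_simps)
  qed
  moreover have "bij_betw \<theta> (carrier Z.B) (carrier Z'.B)"
  proof (rule bij_betw_byWitness[where f' = \<psi>])
    show "\<forall>S\<in>carrier Z.B. \<psi> (\<theta> S) = S"
      using \<psi>_\<theta> by (simp add: carrier_zero_sum_monoid_iff)
    show "\<forall>T\<in>carrier Z'.B. \<theta> (\<psi> T) = T"
      using \<theta>_\<psi> dvd by (simp add: carrier_zero_sum_monoid_iff)
    show "\<theta> ` carrier Z.B \<subseteq> carrier Z'.B"
      using \<open>\<theta> \<in> hom Z.B Z'.B\<close> by (auto simp: hom_def)
    show "\<psi> ` carrier Z'.B \<subseteq> carrier Z.B"
    proof (rule image_subsetI)
      fix T assume "T \<in> carrier Z'.B"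
      then have T: "set_mset T \<subseteq> ?A'" "sequence_sum G T = \<one>\<^bsub>G\<^esub>"
        by (auto simp: carrier_zero_sum_monoid_iff)
      \<comment> \<open>The sum of \<open>\<psi> T\<close> is that of
        \<open>\<theta> (\<psi> T)\<close>, which is \<open>T\<close>.\<close>
      then show "\<psi> T \<in> carrier Z.B"
        using \<psi>_set[OF T(1)] sum_\<theta>[OF \<psi>_set[OF T(1)]] \<theta>_\<psi>[OF T(1) dvd[OF T]]
        by (simp add: carrier_zero_sum_monoid_iff)
    qed
  qed
  ultimately show ?thesis
    using transfer_homomorphism_if_iso Z.B.is_comm_monoid_cancel Z'.B.is_comm_monoid_cancel by blast
qed

section \<open>Generating sets of the integers modulo n\<close>

lemma sequence_sum_integer_mod_group:
  assumes "set_mset S \<subseteq> carrier (integer_mod_group n)"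
  shows "sequence_sum (integer_mod_group n) S = (\<Sum>x\<in>#S. x) mod int n"
proof -
  interpret comm_group "integer_mod_group n" by simp
  show ?thesis using assms
  proof (induction S)
    case (add x S)
    have "sequence_sum (integer_mod_group n) ({#x#} + S) =
        (x + (\<Sum>y\<in>#S. y) mod int n) mod int n"
      using add by (subst sequence_sum_union) (auto simp: sequence_sum_single)
    then show ?case by (simp add: mod_add_right_eq)
  qed (simp add: sequence_sum_empty)
qed

text \<open>Bezout's identity, applied to one element of \<open>A\<close> at a time. The factor
  \<open>z\<close> is kept arbitrary to absorb the Bezout coefficient \<open>v\<close> in the
  induction.\<close>

lemma ex_multiset_sum_cong_Gcd:
  fixes A :: "int set"
  assumes "finite A" "n > 0"
  shows "\<exists>S. set_mset S \<subseteq> A \<and> [(\<Sum>x\<in>#S. x) = z * Gcd A] (mod int n)"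
  using assms(1)
proof (induction A arbitrary: z rule: finite_induct)
  case empty
  show ?case by (intro exI[of _ "{#}"]) simp
next
  case (insert a A)
  obtain u v where uv: "u * a + v * Gcd A = gcd a (Gcd A)" using bezout_int by blast
  obtain S where S: "set_mset S \<subseteq> A" "[(\<Sum>x\<in>#S. x) = z * v * Gcd A] (mod int n)"
    using insert.IH by blast
  \<comment> \<open>A Bezout coefficient may be negative, a multiplicity may not; reduction modulo
    \<open>n\<close> repairs this.\<close>
  define k where "k = nat (z * u mod int n)"
  have k: "[int k = z * u] (mod int n)"
    using \<open>n > 0\<close> by (simp add: k_def cong_def)
  have "[int k * a + (\<Sum>x\<in>#S. x) = z * u * a + z * v * Gcd A] (mod int n)"
    by (intro cong_add cong_mult k S(2) cong_refl)
  also have "z * u * a + z * v * Gcd A = z * Gcd (insert a A)"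
    using arg_cong[OF uv, of "(*) z"] by (simp add: algebra_simps)
  finally show ?case
    using S(1) by (intro exI[of _ "S + repeat_mset k {#a#}"]) (auto simp: add_ac)
qed

text \<open>\<open>Gcd A\<close> is coprime to \<open>n\<close>, and the Bezout coefficient
  \<open>v\<close> inverts it modulo \<open>n\<close>; so \<open>x * v\<close> is the multiple of
  \<open>Gcd A\<close> to aim for.\<close>

lemma integer_mod_group_generated:
  assumes "n > 0" and A: "A \<subseteq> carrier (integer_mod_group n)" "Gcd (insert (int n) A) = 1"
    and x: "x \<in> carrier (integer_mod_group n)"
  shows "\<exists>S. set_mset S \<subseteq> A \<and> sequence_sum (integer_mod_group n) S = x"
proof -
  have "finite A" using A(1) \<open>n > 0\<close> by (auto simp: carrier_integer_mod_group intro: finite_subset)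
  moreover obtain u v where uv: "u * int n + v * Gcd A = 1"
    using bezout_int[of "int n" "Gcd A"] A(2) by auto
  ultimately obtain S where S: "set_mset S \<subseteq> A" "[(\<Sum>x\<in>#S. x) = x * v * Gcd A] (mod int n)"
    using ex_multiset_sum_cong_Gcd \<open>n > 0\<close> by blast
  have "x * v * Gcd A = x - x * u * int n"
    using arg_cong[OF uv, of "(*) x"] by (simp add: algebra_simps)
  then have "[x * v * Gcd A = x] (mod int n)" by (simp add: cong_iff_dvd_diff)
  with S(2) have "[(\<Sum>x\<in>#S. x) = x] (mod int n)" by (rule cong_trans)
  moreover have "x mod int n = x"
    using x \<open>n > 0\<close> by (simp add: carrier_integer_mod_group)
  ultimately have "sequence_sum (integer_mod_group n) S = x"
    using S(1) A(1) sequence_sum_integer_mod_group[of S n] by (simp add: cong_def)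
  then show ?thesis using S(1) by blast
qed

text \<open>Induction on \<open>Gcd (insert (int n) A)\<close>, the index of the subgroup generated
  by \<open>A\<close>. An exchange keeps \<open>h\<close> in the generated subgroup, as a multiple
  of \<open>h'\<close>, and adds \<open>h'\<close>, which was outside; so the index becomes
  smaller.\<close>

lemma ex_generating_set:
  assumes "n > 0" "A \<subseteq> carrier (integer_mod_group n)" "A \<noteq> {}"
  shows "\<exists>A'\<subseteq>carrier (integer_mod_group n). Gcd (insert (int n) A') = 1 \<and>
    Delta (integer_mod_group n) A' = Delta (integer_mod_group n) A"
  using assms(2,3)
proof (induction "nat (Gcd (insert (int n) A))" arbitrary: A rule: less_induct)
  case less
  let ?G = "integer_mod_group n"
  define k where "k = Gcd (insert (int n) A)"
  have k_dvd: "k dvd int n" "\<And>a. a \<in> A \<Longrightarrow> k dvd a" unfolding k_def by (auto intro: Gcd_dvd simp del: Gcd_insert)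
  have "k \<noteq> 0" using \<open>n > 0\<close> k_dvd(1) by auto
  then have "k > 0" using Gcd_int_greater_eq_0[of "insert (int n) A"] by (simp add: k_def)
  show ?case
  proof (cases "k = 1")
    case True
    then show ?thesis using less.prems by (auto simp: k_def)
  next
    case False
    then have "nat k \<noteq> 1" by linarith
    then obtain p where p: "Factorial_Ring.prime p" "p dvd nat k"
      using prime_factor_nat by blast
    then have "int p dvd int (nat k)" by (simp only: int_dvd_int_iff)
    then obtain k' where k': "k = int p * k'" using \<open>k > 0\<close> by auto
    have prime_p: "Factorial_Ring.prime (int p)" using p by simp
    obtain m where m: "int n = k * m" using k_dvd by blast
    have "\<exists>h\<in>A. \<not> int p dvd h div k \<or> \<not> int p dvd m"
    proof (rule ccontr)
      assume "\<not> ?thesis"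
      then have "int p dvd m" "\<And>h. h \<in> A \<Longrightarrow> int p dvd h div k" using \<open>A \<noteq> {}\<close> by auto
      then have "k * int p dvd int n" "\<And>h. h \<in> A \<Longrightarrow> k * int p dvd h"
        using k_dvd m \<open>k > 0\<close> by (auto simp: dvd_div_iff_mult mult.commute)
      then have "k * int p dvd k" unfolding k_def by (auto intro: Gcd_greatest)
      then show False using \<open>k > 0\<close> prime_p by (simp add: not_prime_unit)
    qed
    then obtain h where h: "h \<in> A" "\<not> int p dvd h div k \<or> \<not> int p dvd m" by blast
    obtain x where x: "h = k * x" using h k_dvd by blast
    \<comment> \<open>\<open>k * (x + t * m)\<close> equals \<open>h + t * int n\<close>, so
      \<open>t\<close> selects a representative of the class of \<open>h\<close>. One of 0 and 1
      will do, as \<open>p\<close> does not divide both \<open>x\<close> and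
      \<open>m\<close>.\<close>
    have "\<exists>t. \<not> int p dvd x + t * m"
    proof (cases "int p dvd x")
      case True
      then have "\<not> int p dvd x + 1 * m" using h(2) x \<open>k > 0\<close> by (simp add: dvd_add_right_iff)
      then show ?thesis by blast
    qed (auto intro: exI[of _ 0])
    then obtain t where t: "\<not> int p dvd x + t * m" by blast
    \<comment> \<open>The chosen representative divided by \<open>p\<close>, since \<open>k\<close>
      is \<open>p\<close> times \<open>k'\<close>.\<close>
    define h' where "h' = k' * (x + t * m) mod int n"
    have h'_carr: "h' \<in> carrier ?G" using \<open>n > 0\<close> by (simp add: h'_def carrier_integer_mod_group)
    \<comment> \<open>As \<open>k\<close> divides \<open>n\<close>, reduction modulo
      \<open>n\<close> does not affect divisibility by \<open>k\<close>. Cancelling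
      \<open>k'\<close> leaves \<open>p\<close> as a divisor of \<open>i * (x + t * m)\<close>, and
      \<open>p\<close> is prime.\<close>
    have dvd_h': "int p dvd i" if "k dvd i * h'" for i
    proof -
      have "k dvd (i * h') mod int n" using that k_dvd(1) by (simp add: dvd_mod)
      then have "k dvd (i * (k' * (x + t * m))) mod int n"
        by (simp add: h'_def mod_mult_right_eq)
      then have "int p * k' dvd (i * (x + t * m)) * k'"
        using k_dvd(1) by (simp add: dvd_mod_iff k' mult_ac)
      then have "int p dvd i * (x + t * m)" using k' \<open>k > 0\<close> by auto
      then show ?thesis using t prime_p prime_dvd_mult_iff by blast
    qed
    have not_dvd: "\<not> k dvd h'"
      using dvd_h'[of 1] prime_p by (auto simp: not_prime_unit)
    then have "h' \<notin> A" using k_dvd by blast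
    have "h' [^]\<^bsub>?G\<^esub> p = h"
    proof -
      have "h' [^]\<^bsub>?G\<^esub> p = (int p * (k' * (x + t * m))) mod int n"
        by (simp add: h'_def mod_mult_right_eq)
      also have "int p * (k' * (x + t * m)) = h + t * int n"
        by (simp add: m x k' algebra_simps)
      finally show ?thesis
        using h(1) less.prems(1) \<open>n > 0\<close> by (auto simp: carrier_integer_mod_group)
    qed
    define A' where "A' = insert h' (A - {h})"
    have A': "A' \<subseteq> carrier ?G" "A' \<noteq> {}" using less.prems h'_carr by (auto simp: A'_def)
    \<comment> \<open>\<open>k\<close> divides the whole sum and every term other than
      \<open>h'\<close>, hence also the contribution of \<open>h'\<close>; then
      \<open>dvd_h'\<close> applies.\<close>
    have "p dvd count S h'" if S: "set_mset S \<subseteq> A'" "sequence_sum ?G S = \<one>\<^bsub>?G\<^esub>" for S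
    proof -
      have "(\<Sum>x\<in>#S. x) mod int n = 0"
        using S A' sequence_sum_integer_mod_group[of S n] by auto
      then have "k dvd (\<Sum>x\<in>#S. x)" using k_dvd(1) dvd_trans by blast
      also have "S = filter_mset (\<lambda>x. x \<noteq> h') S + repeat_mset (count S h') {#h'#}"
        by (rule multiset_eqI) simp
      finally have "k dvd (\<Sum>x\<in>#filter_mset (\<lambda>x. x \<noteq> h') S. x) + int (count S h') * h'"
        by simp
      moreover have "k dvd (\<Sum>x\<in>#filter_mset (\<lambda>x. x \<noteq> h') S. x)"
      proof -
        have *: "k dvd (\<Sum>x\<in>#T. x)" if "\<forall>x\<in>#T. k dvd x" for T
          using that by (induction T) auto
        show ?thesis by (rule *) (use S(1) k_dvd(2) in \<open>auto simp: A'_def\<close>)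
      qed
      ultimately have "k dvd int (count S h') * h'" by (simp add: dvd_add_right_iff)
      then have "int p dvd int (count S h')" by (rule dvd_h')
      then show ?thesis by (simp only: int_dvd_int_iff)
    qed
    then obtain \<theta> where "transfer_homomorphism (zero_sum_monoid ?G A) (zero_sum_monoid ?G A') \<theta>"
      using transfer_homomorphism_replace[of ?G A h h' p] less.prems h h'_carr \<open>h' \<notin> A\<close> p(1)
        \<open>h' [^]\<^bsub>?G\<^esub> p = h\<close> prime_gt_0_nat by (auto simp: A'_def)
    then have Delta_eq: "Delta ?G A' = Delta ?G A"
      unfolding Delta_def using transfer_homomorphism.UN_lengths_eq by metis
    have "Gcd (insert (int n) A') dvd k"
      unfolding k_def
    proof (rule Gcd_greatest)
      fix a assume "a \<in> insert (int n) A"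
      \<comment> \<open>\<open>h\<close> may have left the set, but it is still \<open>p\<close>
        times \<open>h'\<close> modulo \<open>n\<close>.\<close>
      moreover have "Gcd (insert (int n) A') dvd h"
      proof -
        have "Gcd (insert (int n) A') dvd (int p * h') mod int n"
          by (intro dvd_mod dvd_mult Gcd_dvd) (auto simp: A'_def)
        then show ?thesis using \<open>h' [^]\<^bsub>?G\<^esub> p = h\<close> by simp
      qed
      ultimately show "Gcd (insert (int n) A') dvd a"
        by (cases "a = h") (auto simp: A'_def intro: Gcd_dvd simp del: Gcd_insert)
    qed
    then have "Gcd (insert (int n) A') \<le> k" using \<open>k > 0\<close> by (rule zdvd_imp_le)
    moreover have "Gcd (insert (int n) A') dvd h'" by (rule Gcd_dvd) (simp add: A'_def)
    then have "Gcd (insert (int n) A') \<noteq> k" using not_dvd by metis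
    ultimately have "nat (Gcd (insert (int n) A')) < nat k" using \<open>k > 0\<close> by linarith
    then show ?thesis using less.hyps[of A'] A' Delta_eq unfolding k_def by metis
  qed
qed

section \<open>Realization of the elements of \<open>Delta_star\<close> and the two
  equivalences\<close>

lemma ex_Krull_monoid_if_Delta_star:
  assumes "n > 0" and m: "m \<in> Delta_star (integer_mod_group n)"
  shows "m > 0 \<and> (\<exists>H :: 'a::infinite monoid. krull_monoid TYPE('p::infinite) H \<and>
    \<not> half_factorial H \<and> has_class_group TYPE('p) H (integer_mod_group n) \<and>
    (\<forall>d. congruence_half_factorial d H \<longleftrightarrow> d dvd m))"
proof -
  let ?G = "integer_mod_group n"
  obtain A\<^sub>0 where A\<^sub>0: "A\<^sub>0 \<subseteq> carrier ?G" "Delta ?G A\<^sub>0 \<noteq> {}" "m = Inf (Delta ?G A\<^sub>0)"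
    using m by (auto simp: Delta_star_def)
  have "A\<^sub>0 \<noteq> {}"
    using A\<^sub>0 zero_sum_sequences.Delta_empty[of ?G A\<^sub>0]
    by (auto simp: zero_sum_sequences_def zero_sum_sequences_axioms_def)
  then obtain A where A: "A \<subseteq> carrier ?G" "Gcd (insert (int n) A) = 1" "Delta ?G A = Delta ?G A\<^sub>0"
    using ex_generating_set A\<^sub>0(1) \<open>n > 0\<close> by metis
  interpret Z: zero_sum_sequences ?G A
    using A by (simp add: zero_sum_sequences_def zero_sum_sequences_axioms_def)
  have "finite (carrier ?G)" using \<open>n > 0\<close> by (simp add: carrier_integer_mod_group)
  then obtain H :: "'a monoid" and \<theta> where H: "krull_monoid TYPE('p) H"
    "has_class_group TYPE('p) H ?G" "transfer_homomorphism H Z.B \<theta>"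
    using ex_Krull_monoid[of ?G A] integer_mod_group_generated[OF \<open>n > 0\<close> A(1,2)] A(1)
    by (metis abelian_integer_mod_group)
  interpret T: transfer_homomorphism H Z.B \<theta> by (rule H(3))
  show ?thesis
    using H A\<^sub>0 A(3) Z.Inf_Delta_pos Z.half_factorial_iff Z.congruence_half_factorial_iff
      T.half_factorial_iff T.congruence_half_factorial_iff by auto
qed

theorem theorem8p2:
  fixes d n :: nat
  assumes "d > 0" and "n > 0"
  shows
    "((\<exists>H :: 'a::infinite monoid.
          krull_monoid TYPE('p::infinite) H \<and>
          \<not> half_factorial H \<and>
          truly_congruence_half_factorial d H \<and>
          has_class_group TYPE('p) H (integer_mod_group n))
        \<longleftrightarrow> d \<in> Delta_star (integer_mod_group n))
     \<and>
     ((\<exists>H :: 'a monoid.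
          krull_monoid TYPE('p) H \<and>
          \<not> half_factorial H \<and>
          congruence_half_factorial d H \<and>
          has_class_group TYPE('p) H (integer_mod_group n))
        \<longleftrightarrow> (\<exists>m \<in> Delta_star (integer_mod_group n). d dvd m))"
proof -
  let ?G = "integer_mod_group n"
  have ex_m: "\<exists>m\<in>Delta_star ?G. \<forall>d. congruence_half_factorial d H \<longleftrightarrow> d dvd m"
    if kr: "krull_monoid TYPE('p) H" and nhf: "\<not> half_factorial H"
      and cl: "has_class_group TYPE('p) H ?G"
    for H :: "'a monoid"
  proof -
    have "comm_monoid_cancel H" using kr by (simp add: krull_monoid_def)
    then obtain A where "A \<subseteq> carrier ?G" "Delta ?G A \<noteq> {}"
      "\<forall>d. congruence_half_factorial d H \<longleftrightarrow> d dvd Inf (Delta ?G A)"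
      using ex_Delta_if_has_class_group[OF _ nhf _ cl] by auto
    then show ?thesis
      unfolding Delta_star_def by (intro bexI[of _ "Inf (Delta ?G A)"]) auto
  qed
  note ex_H = ex_Krull_monoid_if_Delta_star[OF \<open>n > 0\<close>, where 'a = 'a and 'p = 'p]
  \<comment> \<open>\<open>ex_H\<close> contributes \<open>m > 0\<close>, so \<open>m\<close> itself
    is an admissible modulus: if \<open>d\<close> divides \<open>m\<close> and differs from it, then
    \<open>m\<close> is a multiple that violates the truly condition.\<close>
  have truly: "truly_congruence_half_factorial d H \<longleftrightarrow> d = m"
    if "m \<in> Delta_star ?G" "\<forall>d. congruence_half_factorial d H \<longleftrightarrow> d dvd m"
    for H :: "'a monoid" and m
    using that ex_H[OF that(1)] \<open>d > 0\<close> unfolding truly_congruence_half_factorial_def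
    by (metis dvd_antisym dvd_refl)
  show ?thesis
  proof (intro conjI iffI)
    assume "\<exists>H :: 'a monoid. krull_monoid TYPE('p) H \<and> \<not> half_factorial H \<and>
      truly_congruence_half_factorial d H \<and> has_class_group TYPE('p) H ?G"
    then obtain H :: "'a monoid" where H: "krull_monoid TYPE('p) H" "\<not> half_factorial H"
      "truly_congruence_half_factorial d H" "has_class_group TYPE('p) H ?G" by blast
    then show "d \<in> Delta_star ?G" using ex_m[OF H(1,2,4)] truly by blast
  next
    assume d: "d \<in> Delta_star ?G"
    then show "\<exists>H :: 'a monoid. krull_monoid TYPE('p) H \<and> \<not> half_factorial H \<and>
        truly_congruence_half_factorial d H \<and> has_class_group TYPE('p) H ?G"
      using ex_H[OF d] truly[OF d] by blast
  next
    assume "\<exists>H :: 'a monoid. krull_monoid TYPE('p) H \<and> \<not> half_factorial H \<and>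
      congruence_half_factorial d H \<and> has_class_group TYPE('p) H ?G"
    then show "\<exists>m\<in>Delta_star ?G. d dvd m" using ex_m by blast
  next
    assume "\<exists>m\<in>Delta_star ?G. d dvd m"
    then obtain m where m: "m \<in> Delta_star ?G" "d dvd m" by blast
    then show "\<exists>H :: 'a monoid. krull_monoid TYPE('p) H \<and> \<not> half_factorial H \<and>
        congruence_half_factorial d H \<and> has_class_group TYPE('p) H ?G"
      using ex_H[OF m(1)] by blast
  qed
qed

end
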